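(* $\mathbf Y^*=\langle\mathcal P,\le,[1]+[1]\rangle$ has the maximal definability property with respect to $\#$: the first-order definable relations of $\mathbf Y^*$ coincide with the first-order definable relations of $\langle\mathcal P,+_\#,\times_\#\rangle$, i.e. $\mathrm{Def}(\mathcal P,\le,[1]+[1])=\mathrm{Def}(\mathcal P,+_\#,\times_\#)$.
   Context: $\mathcal P$ is the set of all integer partitions, including the empty partition $\emptyset$; a partition is a nonincreasing finite sequence of positive integers (its parts). $[n]$ denotes the partition with a single part $n$, and $m[n]$ the partition with exactly $m$ parts equal to $n$. Every nonempty partition has a unique canonical representation $\sigma=\sum_{i=1}^k m_i[n_i]$ with $n_1>\dots>n_k\ge1$, meaning part $n_i$ occurs exactly $m_i\ge1$ times. Let $p_1=2,p_2=3,\dots$ enumerate the primes. Define the bijection $\#:\mathcal P\to\mathbb N$ by $\#\emptyset=0$; $\#(m[1])=p_1^{m-1}$ for $m\ge1$; and $\#\sigma=\prod_{i=1}^k p_{n_i}^{m_i}$ if $\sigma=\sum m_i[n_i]$ has some part $n_i\neq1$. The ternary relations $+_\#,\times_\#$ on $\mathcal P$ are: $(\rho,\sigma,\pi)\in+_\#$ iff $\#\rho+\#\sigma=\#\pi$, and $(\rho,\sigma,\pi)\in\times_\#$ iff $\#\rho\cdot\#\sigma=\#\pi$. Young's lattice $\mathbf Y=\langle\mathcal P,\le\rangle$ has $(s_1,\dots,s_r)\le(n_1,\dots,n_t)$ iff $r\le t$ and $s_i\le n_i$ for all $i\le r$; $\mathbf Y^*$ is $\mathbf Y$ with a constant symbol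 for $[1]+[1]=(1,1)$. For a structure $A$, $\mathrm{Def}(A)$ denotes the set of all relations (of all arities) on its universe definable by first-order formulas without parameters. *)

theory Defs
  imports Main "HOL-Library.Infinite_Set" "HOL-Computational_Algebra.Primes"
begin

typedef partition = "{xs :: nat list. sorted_wrt (\<ge>) xs \<and> (\<forall>x\<in>set xs. 0 < x)}"
  by (rule exI[of _ "[]"]) simp

definition parts :: "partition \<Rightarrow> nat list" where
  "parts \<sigma> = Rep_partition \<sigma>"

text \<open>The n-th prime, 1-indexed: nth_prime 1 = 2, nth_prime 2 = 3, ...\<close>
definition nth_prime :: "nat \<Rightarrow> nat" where
  "nth_prime n = enumerate {p. prime p} (n - 1)"

text \<open>The coding bijection #. For a partition with some part different from 1,
 the product of nth_prime over the list of parts equals the product over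
 distinct parts n_i of nth_prime n_i ^ m_i.\<close>
definition num :: "partition \<Rightarrow> nat" where
  "num \<sigma> = (let xs = parts \<sigma> in
     if xs = [] then 0
     else if (\<forall>x\<in>set xs. x = 1) then 2 ^ (length xs - 1)
     else prod_list (map nth_prime xs))"

definition plus_rel :: "partition \<Rightarrow> partition \<Rightarrow> partition \<Rightarrow> bool" where
  "plus_rel \<rho> \<sigma> \<pi> \<longleftrightarrow> num \<rho> + num \<sigma> = num \<pi>"

definition times_rel :: "partition \<Rightarrow> partition \<Rightarrow> partition \<Rightarrow> bool" where
  "times_rel \<rho> \<sigma> \<pi> \<longleftrightarrow> num \<rho> * num \<sigma> = num \<pi>"

definition young_le :: "partition \<Rightarrow> partition \<Rightarrow> bool" where
  "young_le \<sigma> \<tau> \<longleftrightarrow> length (parts \<sigma>) \<le> length (parts \<tau>) \<and>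
     (\<forall>i < length (parts \<sigma>). parts \<sigma> ! i \<le> parts \<tau> ! i)"

definition two_ones :: partition where
  "two_ones = Abs_partition [1, 1]"

datatype 'c trm = Var nat | Cst 'c

datatype ('r, 'c) fm =
    FEq "'c trm" "'c trm"
  | FRel 'r "'c trm list"
  | FNeg "('r, 'c) fm"
  | FConj "('r, 'c) fm" "('r, 'c) fm"
  | FEx nat "('r, 'c) fm"

fun tvars :: "'c trm \<Rightarrow> nat set" where
  "tvars (Var i) = {i}"
| "tvars (Cst c) = {}"

fun tcsts :: "'c trm \<Rightarrow> 'c set" where
  "tcsts (Var i) = {}"
| "tcsts (Cst c) = {c}"

fun fv :: "('r, 'c) fm \<Rightarrow> nat set" where
  "fv (FEq s t) = tvars s \<union> tvars t"
| "fv (FRel r ts) = (\<Union>t\<in>set ts. tvars t)"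
| "fv (FNeg \<phi>) = fv \<phi>"
| "fv (FConj \<phi> \<psi>) = fv \<phi> \<union> fv \<psi>"
| "fv (FEx x \<phi>) = fv \<phi> - {x}"

fun csts :: "('r, 'c) fm \<Rightarrow> 'c set" where
  "csts (FEq s t) = tcsts s \<union> tcsts t"
| "csts (FRel r ts) = (\<Union>t\<in>set ts. tcsts t)"
| "csts (FNeg \<phi>) = csts \<phi>"
| "csts (FConj \<phi> \<psi>) = csts \<phi> \<union> csts \<psi>"
| "csts (FEx x \<phi>) = csts \<phi>"

fun teval :: "('c \<Rightarrow> 'a) \<Rightarrow> (nat \<Rightarrow> 'a) \<Rightarrow> 'c trm \<Rightarrow> 'a" where
  "teval C e (Var i) = e i"
| "teval C e (Cst c) = C c"

fun sat :: "('r \<Rightarrow> 'a list \<Rightarrow> bool) \<Rightarrow> ('c \<Rightarrow> 'a) \<Rightarrow> (nat \<Rightarrow> 'a) \<Rightarrow> ('r, 'c) fm \<Rightarrow> bool" where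
  "sat I C e (FEq s t) = (teval C e s = teval C e t)"
| "sat I C e (FRel r ts) = I r (map (teval C e) ts)"
| "sat I C e (FNeg \<phi>) = (\<not> sat I C e \<phi>)"
| "sat I C e (FConj \<phi> \<psi>) = (sat I C e \<phi> \<and> sat I C e \<psi>)"
| "sat I C e (FEx x \<phi>) = (\<exists>a. sat I C (e(x := a)) \<phi>)"

text \<open>Def(A): all relations (of every arity n, a relation being a set of
n-tuples, represented as lists of length n) definable without parameters by a
first-order formula of the signature of A. The signature consists of all
relation symbols of type 'r and the constant symbols in CS.\<close>
definition Def :: "('r \<Rightarrow> 'a list \<Rightarrow> bool) \<Rightarrow> 'c set \<Rightarrow> ('c \<Rightarrow> 'a) \<Rightarrow> 'a list set set" where
  "Def I CS C = {R. \<exists>n \<phi>. fv \<phi> \<subseteq> {..<n} \<and> csts \<phi> \<subseteq> CS \<and>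
       R = {xs. length xs = n \<and> sat I C (\<lambda>i. xs ! i) \<phi>}}"

fun Ystar_rel :: "unit \<Rightarrow> partition list \<Rightarrow> bool" where
  "Ystar_rel _ xs = (case xs of [a, b] \<Rightarrow> young_le a b | _ \<Rightarrow> False)"

definition Ystar_cst :: "unit \<Rightarrow> partition" where
  "Ystar_cst _ = two_ones"

fun arith_rel :: "bool \<Rightarrow> partition list \<Rightarrow> bool" where
  "arith_rel b xs = (case xs of [x, y, z] \<Rightarrow> (if b then plus_rel x y z else times_rel x y z)
                     | _ \<Rightarrow> False)"

definition no_cst :: "unit \<Rightarrow> partition" where
  "no_cst _ = Abs_partition []"

end

theory Submission
  imports Defs "HOL-Number_Theory.Cong"
begin

text \<open>
  A partition is an antitone, finitely supported function \<open>pt \<sigma>\<close>, and Young's order is the pointwise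
  order. In \<open>Y*\<close> the constant \<open>(1,1)\<close> singles out the one-row partitions, hence the comparison of first
  parts and, dually, of lengths; the largest partition with bounded length and first part is a
  rectangle, which gives access to the individual parts. Staircases are exactly the partitions whose
  parts strictly decrease and omit no value; they identify lengths with first parts and define
  addition, and the partition with parts \<open>m, \<dots>, 1\<close>, each repeated \<open>x\<close> times, defines multiplication.
  So \<open>Y*\<close> interprets arithmetic on first parts. Goedel's beta function makes primitive recursion
  definable, in particular the coding \<open>#\<close> as a product of primes over the parts. Conversely, in
  \<open>(+#, \<times>#)\<close> the parts of a partition are quantified over as beta-coded sequences, and Young's order
  is read off from them.
\<close>

section \<open>Definable relations\<close>

lemma finite_fv: "finite (fv \<phi>)"
proof (induction \<phi>)
  case (FEq s t) then show ?case by (cases s; cases t) auto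
next
  case (FRel r ts)
  have "finite (tvars t)" for t :: "'b trm" by (cases t) auto
  then show ?case by auto
qed auto

lemma teval_cong: "(\<And>i. i \<in> tvars t \<Longrightarrow> e i = e' i) \<Longrightarrow> teval C e t = teval C e' t"
  by (cases t) auto

lemma sat_cong: "(\<And>i. i \<in> fv \<phi> \<Longrightarrow> e i = e' i) \<Longrightarrow> sat I C e \<phi> = sat I C e' \<phi>"
proof (induction \<phi> arbitrary: e e')
  case (FEq s t)
  then show ?case using teval_cong[of s e e' C] teval_cong[of t e e' C] by auto
next
  case (FRel r ts)
  have "map (teval C e) ts = map (teval C e') ts"
    using FRel by (intro map_cong refl teval_cong) auto
  then show ?case by (simp del: map_eq_conv)
next
  case (FNeg \<phi>)
  have "sat I C e \<phi> = sat I C e' \<phi>" by (rule FNeg.IH) (use FNeg.prems in auto)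
  then show ?case by simp
next
  case (FConj \<phi> \<psi>)
  have "sat I C e \<phi> = sat I C e' \<phi>" "sat I C e \<psi> = sat I C e' \<psi>"
    using FConj.prems by (auto intro!: FConj.IH)
  then show ?case by simp
next
  case (FEx x \<phi>)
  have "sat I C (e(x := a)) \<phi> = sat I C (e'(x := a)) \<phi>" for a
    by (rule FEx.IH) (use FEx.prems in auto)
  then show ?case by simp
qed

text \<open>\<open>h\<close> may be any map, so variables can be identified as well as permuted;
  only bound variables need care.\<close>

lemma sat_rename:
  "\<exists>\<psi>. csts \<psi> = csts \<phi> \<and> (\<forall>e. sat I C e \<psi> = sat I C (\<lambda>i. e (h i)) \<phi>)"
proof (induction \<phi> arbitrary: h)
  case (FEq s t)
  define r where "r = (\<lambda>t :: 'b trm. case t of Var i \<Rightarrow> Var (h i) | Cst c \<Rightarrow> Cst c)"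
  have r: "tcsts (r t) = tcsts t" "teval C e (r t) = teval C (\<lambda>i. e (h i)) t" for e t
    by (cases t; simp add: r_def)+
  show ?case by (rule exI[of _ "FEq (r s) (r t)"]) (simp add: r)
next
  case (FRel R ts)
  define r where "r = (\<lambda>t :: 'b trm. case t of Var i \<Rightarrow> Var (h i) | Cst c \<Rightarrow> Cst c)"
  have r: "tcsts (r t) = tcsts t" "teval C e (r t) = teval C (\<lambda>i. e (h i)) t" for e t
    by (cases t; simp add: r_def)+
  show ?case by (rule exI[of _ "FRel R (map r ts)"]) (simp add: r comp_def)
next
  case (FNeg \<phi>)
  obtain \<psi> where "csts \<psi> = csts \<phi>" "\<forall>e. sat I C e \<psi> = sat I C (\<lambda>i. e (h i)) \<phi>"
    using FNeg by blast
  then show ?case by (intro exI[of _ "FNeg \<psi>"]) auto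
next
  case (FConj \<phi>1 \<phi>2)
  obtain \<psi>1 where "csts \<psi>1 = csts \<phi>1" "\<forall>e. sat I C e \<psi>1 = sat I C (\<lambda>i. e (h i)) \<phi>1"
    using FConj(1) by blast
  moreover obtain \<psi>2 where "csts \<psi>2 = csts \<phi>2" "\<forall>e. sat I C e \<psi>2 = sat I C (\<lambda>i. e (h i)) \<phi>2"
    using FConj(2) by blast
  ultimately show ?case by (intro exI[of _ "FConj \<psi>1 \<psi>2"]) auto
next
  case (FEx x \<phi>)
  \<comment> \<open>The new bound variable avoids every renamed free variable of the body, so that
    updating \<open>y\<close> changes nothing except the value read for \<open>x\<close>.\<close>
  obtain y where y: "y \<notin> h ` fv \<phi>"
    using ex_new_if_finite[OF infinite_UNIV_nat] finite_fv by (metis finite_imageI)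
  obtain \<psi> where \<psi>: "csts \<psi> = csts \<phi>"
      "\<forall>e. sat I C e \<psi> = sat I C (\<lambda>i. e ((h(x := y)) i)) \<phi>"
    using FEx by blast
  have "sat I C (e(y := a)) \<psi> = sat I C ((\<lambda>i. e (h i))(x := a)) \<phi>" for e a
    unfolding \<psi>(2)[rule_format] by (rule sat_cong) (use y in auto)
  with \<psi>(1) show ?case by (intro exI[of _ "FEx y \<psi>"]) auto
qed

section \<open>Closure properties of definable predicates\<close>

locale fo_structure =
  fixes I :: "'r \<Rightarrow> 'a list \<Rightarrow> bool" and CS :: "'c set" and C :: "'c \<Rightarrow> 'a"
begin

text \<open>Predicates are taken on whole assignments, without an arity, so that they can be
  combined freely; arities return only in \<open>dfn_Def\<close>.\<close>

definition dfn :: "((nat \<Rightarrow> 'a) \<Rightarrow> bool) \<Rightarrow> bool" where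
  "dfn P \<longleftrightarrow> (\<exists>\<phi>. csts \<phi> \<subseteq> CS \<and> (\<forall>e. sat I C e \<phi> = P e))"

lemma dfnI: "csts \<phi> \<subseteq> CS \<Longrightarrow> (\<And>e. sat I C e \<phi> = P e) \<Longrightarrow> dfn P"
  unfolding dfn_def by blast

lemma dfn_not: "dfn P \<Longrightarrow> dfn (\<lambda>e. \<not> P e)"
  unfolding dfn_def by (elim exE, rule_tac x = "FNeg \<phi>" in exI) simp

lemma dfn_conj:
  assumes "dfn P" "dfn Q" shows "dfn (\<lambda>e. P e \<and> Q e)"
proof -
  obtain \<phi> \<psi> where "csts \<phi> \<subseteq> CS" "\<forall>e. sat I C e \<phi> = P e" "csts \<psi> \<subseteq> CS" "\<forall>e. sat I C e \<psi> = Q e"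
    using assms unfolding dfn_def by blast
  then show ?thesis by (intro dfnI[of "FConj \<phi> \<psi>"]) auto
qed

lemma dfn_disj: "dfn P \<Longrightarrow> dfn Q \<Longrightarrow> dfn (\<lambda>e. P e \<or> Q e)"
  using dfn_not[OF dfn_conj[OF dfn_not dfn_not], of P Q] by simp

lemma dfn_imp: "dfn P \<Longrightarrow> dfn Q \<Longrightarrow> dfn (\<lambda>e. P e \<longrightarrow> Q e)"
  unfolding imp_conv_disj by (intro dfn_disj dfn_not)

lemma dfn_ex_upd: "dfn P \<Longrightarrow> dfn (\<lambda>e. \<exists>a. P (e(x := a)))"
  unfolding dfn_def by (elim exE, rule_tac x = "FEx x \<phi>" in exI) simp

lemma dfn_rename:
  assumes "dfn P" shows "dfn (\<lambda>e. P (\<lambda>i. e (h i)))"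
proof -
  obtain \<phi> where \<phi>: "csts \<phi> \<subseteq> CS" "\<forall>e. sat I C e \<phi> = P e"
    using assms unfolding dfn_def by blast
  obtain \<psi> where "csts \<psi> = csts \<phi>" "\<forall>e. sat I C e \<psi> = sat I C (\<lambda>i. e (h i)) \<phi>"
    using sat_rename[of \<phi> I C h] by auto
  with \<phi> show ?thesis by (intro dfnI[of \<psi>]) auto
qed

text \<open>The bound variable becomes coordinate 0 and the outer ones are shifted by one. Thus a
  definability goal about a HOL formula is solved by resolution along its syntax.\<close>
lemma dfn_ex:
  assumes "dfn (\<lambda>e. P (e 0) (\<lambda>i. e (Suc i)))" shows "dfn (\<lambda>e. \<exists>a. P a e)"
proof -
  obtain \<phi> where \<phi>: "csts \<phi> \<subseteq> CS" "\<forall>e. sat I C e \<phi> = P (e 0) (\<lambda>i. e (Suc i))"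
    using assms unfolding dfn_def by blast
  \<comment> \<open>Below, \<open>h\<close> sends the bound coordinate 0 to \<open>y\<close> and
    undoes the shift of the others; this choice of \<open>y\<close> keeps the unshifted coordinates
    apart from it.\<close>
  obtain y where y: "y \<notin> (\<lambda>i. i - 1) ` fv \<phi>"
    using ex_new_if_finite[OF infinite_UNIV_nat] finite_fv by (metis finite_imageI)
  define h where "h = (\<lambda>i. if i = 0 then y else i - 1)"
  obtain \<psi> where \<psi>: "csts \<psi> = csts \<phi>" "\<forall>e. sat I C e \<psi> = sat I C (\<lambda>i. e (h i)) \<phi>"
    using sat_rename[of \<phi> I C h] by auto
  have "sat I C (e(y := a)) \<psi> = P a e" for e a
  proof -
    have "sat I C (e(y := a)) \<psi> = sat I C (case_nat a e) \<phi>"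
      unfolding \<psi>(2)[rule_format] using y
      by (intro sat_cong) (force simp: h_def split: nat.split)
    then show ?thesis using \<phi>(2) by simp
  qed
  with \<phi>(1) \<psi>(1) show ?thesis by (intro dfnI[of "FEx y \<psi>"]) auto
qed

lemma dfn_all:
  assumes "dfn (\<lambda>e. P (e 0) (\<lambda>i. e (Suc i)))" shows "dfn (\<lambda>e. \<forall>a. P a e)"
  using dfn_not[OF dfn_ex[of "\<lambda>a e. \<not> P a e", OF dfn_not[OF assms]]] by simp

lemma dfn_eq: "dfn (\<lambda>e. e i = e j)"
  by (rule dfnI[of "FEq (Var i) (Var j)"]) auto

text \<open>An element with a definable graph may stand as an argument: its value is quantified and
  tied to the graph. This is how the constant \<open>two_ones\<close> gets into definable
  predicates.\<close>

lemma dfn_subst_elem: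
  assumes "dfn (\<lambda>e. R (\<lambda>i. e (Suc i)) (e 0))" "dfn (\<lambda>e. e 0 = t (\<lambda>i. e (Suc i)))"
  shows "dfn (\<lambda>e. R e (t e))"
proof -
  have "dfn (\<lambda>e. \<exists>a. a = t e \<and> R e a)" by (intro dfn_ex dfn_conj assms)
  then show ?thesis by simp
qed

lemma dfn_const: "c \<in> CS \<Longrightarrow> dfn (\<lambda>e. e i = C c)"
  by (rule dfnI[of "FEq (Var i) (Cst c)"]) auto

lemma dfn_iff: "dfn P \<Longrightarrow> dfn Q \<Longrightarrow> dfn (\<lambda>e. P e \<longleftrightarrow> Q e)"
  unfolding iff_conv_conj_imp by (intro dfn_conj dfn_imp)

lemmas dfn_logic = dfn_not dfn_conj dfn_disj dfn_imp dfn_iff dfn_ex dfn_all dfn_eq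

text \<open>The defining formula of \<open>dfn\<close> may have spurious free variables; they are quantified away.\<close>
lemma dfn_Def:
  assumes "dfn P" and loc: "\<And>e e'. (\<And>i. i < n \<Longrightarrow> e i = e' i) \<Longrightarrow> P e = P e'"
  shows "{xs. length xs = n \<and> P (\<lambda>i. xs ! i)} \<in> Def I CS C"
proof -
  have ex: "\<exists>\<psi>. fv \<psi> = fv \<phi> - set ys \<and> csts \<psi> = csts \<phi> \<and>
      (\<forall>e. sat I C e \<psi> \<longleftrightarrow> (\<exists>e'. (\<forall>i. i \<notin> set ys \<longrightarrow> e' i = e i) \<and> sat I C e' \<phi>))"
    for ys and \<phi> :: "('r, 'c) fm"
  proof (induction ys)
    case Nil
    have "(\<exists>e'. (\<forall>i. e' i = e i) \<and> sat I C e' \<phi>) = sat I C e \<phi>" for e by (metis ext)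
    then show ?case by (intro exI[of _ \<phi>]) simp
  next
    case (Cons y ys)
    then obtain \<psi> where \<psi>: "fv \<psi> = fv \<phi> - set ys" "csts \<psi> = csts \<phi>"
      "\<And>e. sat I C e \<psi> \<longleftrightarrow> (\<exists>e'. (\<forall>i. i \<notin> set ys \<longrightarrow> e' i = e i) \<and> sat I C e' \<phi>)" by blast
    have "(\<exists>a. sat I C (e(y := a)) \<psi>) \<longleftrightarrow>
        (\<exists>e'. (\<forall>i. i \<notin> set (y # ys) \<longrightarrow> e' i = e i) \<and> sat I C e' \<phi>)" for e
    proof
      assume "\<exists>a. sat I C (e(y := a)) \<psi>"
      then obtain a e' where "\<forall>i. i \<notin> set ys \<longrightarrow> e' i = (e(y := a)) i" "sat I C e' \<phi>"
        unfolding \<psi>(3) by blast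
      then show "\<exists>e'. (\<forall>i. i \<notin> set (y # ys) \<longrightarrow> e' i = e i) \<and> sat I C e' \<phi>"
        by (intro exI[of _ e']) auto
    next
      assume "\<exists>e'. (\<forall>i. i \<notin> set (y # ys) \<longrightarrow> e' i = e i) \<and> sat I C e' \<phi>"
      then obtain e' where "\<forall>i. i \<notin> set (y # ys) \<longrightarrow> e' i = e i" "sat I C e' \<phi>" by blast
      then show "\<exists>a. sat I C (e(y := a)) \<psi>"
        unfolding \<psi>(3) by (intro exI[of _ "e' y"] exI[of _ e']) auto
    qed
    with \<psi>(1,2) show ?case by (intro exI[of _ "FEx y \<psi>"]) auto
  qed
  obtain \<phi> where \<phi>: "csts \<phi> \<subseteq> CS" "\<And>e. sat I C e \<phi> = P e"
    using assms(1) unfolding dfn_def by blast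
  obtain ys where ys: "set ys = fv \<phi> - {..<n}"
    using finite_list[of "fv \<phi> - {..<n}"] finite_fv by blast
  obtain \<psi> where \<psi>: "fv \<psi> = fv \<phi> - set ys" "csts \<psi> = csts \<phi>"
      "\<And>e. sat I C e \<psi> \<longleftrightarrow> (\<exists>e'. (\<forall>i. i \<notin> set ys \<longrightarrow> e' i = e i) \<and> sat I C e' \<phi>)"
    using ex[of \<phi> ys] by blast
  \<comment> \<open>The variables quantified away all have index at least \<open>n\<close>, so by
    \<open>loc\<close> changing their values does not affect \<open>P\<close>.\<close>
  have "sat I C e \<psi> = P e" for e
    unfolding \<psi>(3) \<phi>(2) ys using loc by (metis Diff_iff lessThan_iff)
  with \<phi>(1) \<psi>(1,2) ys show ?thesis
    unfolding Def_def by (intro CollectI exI[of _ n] exI[of _ \<psi>]) auto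
qed

text \<open>Both structures share the universe, so negation, conjunction and quantification carry
  over unchanged and only atomic formulas have to be translated.\<close>

lemma Def_subset:
  assumes atoms:
    "\<And>s t. csts (FEq s t :: ('r1, 'c1) fm) \<subseteq> CS1 \<Longrightarrow> dfn (\<lambda>e. sat I1 C1 e (FEq s t))"
    "\<And>R ts. csts (FRel R ts :: ('r1, 'c1) fm) \<subseteq> CS1 \<Longrightarrow> dfn (\<lambda>e. sat I1 C1 e (FRel R ts))"
  shows "Def I1 CS1 C1 \<subseteq> Def I CS C"
proof
  fix R assume "R \<in> Def I1 CS1 C1"
  then obtain n \<phi> where \<phi>: "fv \<phi> \<subseteq> {..<n}" "csts \<phi> \<subseteq> CS1"
    "R = {xs. length xs = n \<and> sat I1 C1 (\<lambda>i. xs ! i) \<phi>}"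
    unfolding Def_def by blast
  have "dfn (\<lambda>e. sat I1 C1 e \<phi>)" using \<phi>(2)
  proof (induction \<phi>)
    case (FNeg \<phi>) then show ?case by (simp add: dfn_not)
  next
    case (FConj \<phi> \<psi>) then show ?case by (simp add: dfn_conj)
  next
    case (FEx x \<phi>) then show ?case
      using dfn_ex_upd[of "\<lambda>e. sat I1 C1 e \<phi>" x] by simp
  qed (use atoms in blast)+
  then show "R \<in> Def I CS C"
    unfolding \<phi>(3) using \<phi>(1) by (intro dfn_Def sat_cong) auto
qed

end

section \<open>Arithmetic through a surjection onto the naturals\<close>

text \<open>Goedel's beta function: remainders modulo \<open>1 + (i + 1) * b\<close> let two numbers
  encode a finite sequence of any length.\<close>

definition beta :: "nat \<Rightarrow> nat \<Rightarrow> nat \<Rightarrow> nat" where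
  "beta a b i = a mod Suc (Suc i * b)"

text \<open>A common prime of both moduli divides their difference \<open>(j - i) * b\<close> but
  not \<open>b\<close>, hence it divides \<open>j - i\<close>; as \<open>j - i\<close> divides
  \<open>b\<close>, this is absurd.\<close>

lemma coprime_beta_moduli:
  assumes "i < j" "j < n" "\<And>k. 0 < k \<Longrightarrow> k \<le> n \<Longrightarrow> k dvd b"
  shows "coprime (Suc (Suc i * b)) (Suc (Suc j * b))"
proof (rule ccontr)
  assume "\<not> ?thesis"
  then obtain q where q: "prime q" "q dvd Suc (Suc i * b)" "q dvd Suc (Suc j * b)"
    using prime_factor_nat[of "gcd (Suc (Suc i * b)) (Suc (Suc j * b))"]
    by (auto simp: coprime_iff_gcd_eq_1 simp del: mult_Suc)
  have nb: "\<not> q dvd b"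
  proof
    assume "q dvd b"
    then have "q dvd Suc i * b" by simp
    with q(2) have "q dvd 1" using dvd_add_right_iff[of q "Suc i * b" 1] by simp
    with q(1) show False by simp
  qed
  have "Suc (Suc j * b) - Suc (Suc i * b) = (j - i) * b"
    by (simp add: diff_mult_distrib)
  then have "q dvd (j - i) * b" using q(2,3) by (metis dvd_diff_nat)
  with nb q(1) have "q dvd j - i" using prime_dvd_mult_iff by blast
  moreover have "j - i dvd b" using assms by simp
  ultimately show False using nb dvd_trans by blast
qed

lemma beta_surj: "\<exists>a b. \<forall>i<n. beta a b i = s i"
proof -
  \<comment> \<open>\<open>N \<ge> n\<close> makes the moduli coprime once \<open>b\<close> is the
    factorial of \<open>N\<close>; \<open>N \<ge> s i\<close> puts every value below its modulus, so
    that congruence, as given by the Chinese remainder theorem, becomes equality.\<close>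
  define N where "N = n + (\<Sum>i<n. s i)"
  define b where "b = (fact N :: nat)"
  have bd: "k dvd b" if "0 < k" "k \<le> N" for k
    unfolding b_def using that by (intro dvd_fact) auto
  have cop: "coprime (Suc (Suc i * b)) (Suc (Suc j * b))" if "i < n" "j < n" "i \<noteq> j" for i j
  proof -
    have "k dvd b" if "0 < k" "k \<le> n" for k using bd[of k] that by (simp add: N_def)
    then show ?thesis
      using that coprime_beta_moduli[of i j n b] coprime_beta_moduli[of j i n b]
      by (cases i j rule: linorder_cases) (auto simp: coprime_commute)
  qed
  obtain a where a: "\<forall>i\<in>{..<n}. [a = s i] (mod Suc (Suc i * b))"
    using chinese_remainder_nat[of "{..<n}" "\<lambda>i. Suc (Suc i * b)" s] cop by auto
  have "beta a b i = s i" if "i < n" for i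
  proof -
    have "s i \<le> N" using that member_le_sum[of i "{..<n}" s] by (simp add: N_def)
    also have "N \<le> b" unfolding b_def by (rule fact_ge_self)
    also have "b < Suc (Suc i * b)" by simp
    finally show ?thesis using a that by (simp add: beta_def cong_def)
  qed
  then show ?thesis by blast
qed

text \<open>The case distinction of \<open>num\<close>, stated for a sequence with a length, so that
  it applies both to the rows of a partition and to a beta-coded sequence.\<close>

definition code_val :: "(nat \<Rightarrow> nat) \<Rightarrow> nat \<Rightarrow> nat" where
  "code_val s l = (if l = 0 then 0 else if \<forall>i. i < l \<longrightarrow> s i = 1 then 2 ^ (l - 1)
     else (\<Prod>i<l. nth_prime (s i)))"

text \<open>A number is represented by any element of its fibre under \<open>g\<close>; surjectivity lets quantifiers over
  numbers range over the whole universe, so nothing has to be relativised.\<close>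
locale additive_structure = fo_structure I CS C
  for I :: "'r \<Rightarrow> 'a list \<Rightarrow> bool" and CS :: "'c set" and C :: "'c \<Rightarrow> 'a" +
  fixes g :: "'a \<Rightarrow> nat"
  assumes surj_g: "surj g"
    and dfn_g_eq: "\<And>i j. dfn (\<lambda>e. g (e i) = g (e j))"
    and dfn_g_plus: "\<And>i j k. dfn (\<lambda>e. g (e i) + g (e j) = g (e k))"
begin

lemma dfn_exn:
  assumes "dfn (\<lambda>e. P (g (e 0)) (\<lambda>i. e (Suc i)))" shows "dfn (\<lambda>e. \<exists>k. P k e)"
proof -
  have "(\<exists>k. P k e) \<longleftrightarrow> (\<exists>a. P (g a) e)" for e using surj_g by (metis surjD)
  then show ?thesis using dfn_ex[of "\<lambda>a. P (g a)"] assms by simp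
qed

lemma dfn_alln:
  assumes "dfn (\<lambda>e. P (g (e 0)) (\<lambda>i. e (Suc i)))" shows "dfn (\<lambda>e. \<forall>k. P k e)"
  using dfn_not[OF dfn_exn[of "\<lambda>a e. \<not> P a e", OF dfn_not[OF assms]]] by simp

text \<open>The graph keeps its value in coordinate 0 and shifts the parameters by one, the same
  convention as for bound variables; terms can then be nested by quantifying over intermediate
  values.\<close>

definition dfn_term :: "((nat \<Rightarrow> 'a) \<Rightarrow> nat) \<Rightarrow> bool" where
  "dfn_term t \<longleftrightarrow> dfn (\<lambda>e. t (\<lambda>i. e (Suc i)) = g (e 0))"

lemma dfn_term_rename: "dfn_term t \<Longrightarrow> dfn_term (\<lambda>e. t (\<lambda>i. e (h i)))"
  unfolding dfn_term_def
  using dfn_rename[of "\<lambda>e. t (\<lambda>i. e (Suc i)) = g (e 0)" "case_nat 0 (\<lambda>i. Suc (h i))"] by simp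

lemma dfn_subst:
  assumes "dfn (\<lambda>e. R (\<lambda>i. e (Suc i)) (g (e 0)))" "dfn_term s"
  shows "dfn (\<lambda>e. R e (s e))"
proof -
  have "dfn (\<lambda>e. \<exists>k. s e = k \<and> R e k)"
    by (intro dfn_exn dfn_conj assms(1) assms(2)[unfolded dfn_term_def])
  then show ?thesis by simp
qed

lemma dfn_term_subst:
  assumes "dfn_term (\<lambda>e. H (\<lambda>i. e (Suc i)) (g (e 0)))" "dfn_term s"
  shows "dfn_term (\<lambda>e. H e (s e))"
  unfolding dfn_term_def
proof (rule dfn_subst[where R = "\<lambda>e k. H (\<lambda>i. e (Suc i)) k = g (e 0)"])
  show "dfn (\<lambda>e. H (\<lambda>i. e (Suc (Suc i))) (g (e 0)) = g (e (Suc 0)))"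
    \<comment> \<open>In the assumption coordinate 0 holds the value of \<open>H\<close> and
      coordinate 1 its argument; here they trade places.\<close>
    using dfn_rename[OF assms(1)[unfolded dfn_term_def], of "\<lambda>i. if i = 0 then 1 else if i = 1 then 0 else i"]
    by simp
  show "dfn_term (\<lambda>e. s (\<lambda>i. e (Suc i)))" by (rule dfn_term_rename[OF assms(2)])
qed

lemma dfn_term_subst2:
  assumes "dfn_term (\<lambda>e. H (\<lambda>i. e (Suc (Suc i))) (g (e (Suc 0))) (g (e 0)))" "dfn_term s" "dfn_term t"
  shows "dfn_term (\<lambda>e. H e (s e) (t e))"
proof (rule dfn_term_subst[where H = "\<lambda>e x. H e x (t e)", OF _ assms(2)],
    rule dfn_term_subst[where H = "\<lambda>e x. H (\<lambda>i. e (Suc i)) (g (e 0)) x"])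
  show "dfn_term (\<lambda>e. t (\<lambda>i. e (Suc i)))" by (rule dfn_term_rename[OF assms(3)])
qed (use assms(1) in simp)

lemma dfn_term_var: "dfn_term (\<lambda>e. g (e i))"
  unfolding dfn_term_def by (rule dfn_g_eq)

lemma dfn_eqn: "dfn_term s \<Longrightarrow> dfn_term t \<Longrightarrow> dfn (\<lambda>e. s e = t e)"
  by (rule dfn_subst[where R = "\<lambda>e x. s e = x"]) (simp add: dfn_term_def)

lemma dfn_term_graph2:
  assumes "\<And>i j k. dfn (\<lambda>e. F (g (e i)) (g (e j)) = g (e k))" "dfn_term s" "dfn_term t"
  shows "dfn_term (\<lambda>e. F (s e) (t e))"
  by (rule dfn_term_subst2[where H = "\<lambda>e. F"]) (use assms in \<open>auto simp: dfn_term_def\<close>)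

lemma dfn_term_plus: "dfn_term s \<Longrightarrow> dfn_term t \<Longrightarrow> dfn_term (\<lambda>e. s e + t e)"
  by (rule dfn_term_graph2[where F = "(+)", OF dfn_g_plus])

text \<open>Zero is the only solution of \<open>x + x = x\<close>.\<close>

lemma dfn_term_0: "dfn_term (\<lambda>e. 0)"
proof -
  have "dfn_term (\<lambda>e. 0) = dfn (\<lambda>e. g (e 0) + g (e 0) = g (e 0))"
    unfolding dfn_term_def by (intro arg_cong[where f = dfn]) auto
  then show ?thesis by (simp only:) (rule dfn_g_plus)
qed

text \<open>One is the nonzero number that is not a sum of two nonzero numbers, a description by
  addition alone.\<close>

lemma dfn_term_1: "dfn_term (\<lambda>e. Suc 0)"
proof -
  have "Suc 0 = k \<longleftrightarrow> \<not> k = 0 \<and> (\<forall>a b. a + b = k \<longrightarrow> a = 0 \<or> b = 0)" for k :: nat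
  proof
    assume *: "\<not> k = 0 \<and> (\<forall>a b. a + b = k \<longrightarrow> a = 0 \<or> b = 0)"
    then have "1 + (k - 1) = k \<longrightarrow> (1::nat) = 0 \<or> k - 1 = 0" by (elim conjE allE)
    with * show "Suc 0 = k" by simp
  qed auto
  then show ?thesis
    unfolding dfn_term_def
    by (simp only:) (intro dfn_logic dfn_alln dfn_eqn dfn_term_plus dfn_term_var dfn_term_0)
qed

lemma dfn_term_Suc: "dfn_term s \<Longrightarrow> dfn_term (\<lambda>e. Suc (s e))"
  using dfn_term_plus[OF _ dfn_term_1] by simp

lemma dfn_term_One: "dfn_term (\<lambda>e. 1)"
  using dfn_term_1 by simp

lemma dfn_term_Two: "dfn_term (\<lambda>e. 2)"
  using dfn_term_Suc[OF dfn_term_1] by (simp add: numeral_2_eq_2)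

lemma dfn_le:
  assumes s: "dfn_term s" and t: "dfn_term t" shows "dfn (\<lambda>e. s e \<le> t e)"
  unfolding le_iff_add
  by (intro dfn_exn dfn_eqn dfn_term_plus dfn_term_var dfn_term_rename[OF s] dfn_term_rename[OF t])

lemma dfn_less: "dfn_term s \<Longrightarrow> dfn_term t \<Longrightarrow> dfn (\<lambda>e. s e < t e)"
  unfolding Suc_le_eq[symmetric] by (intro dfn_le dfn_term_Suc)

lemmas dfn_additive = dfn_logic dfn_exn dfn_alln dfn_eqn dfn_le dfn_less dfn_term_var dfn_term_0
  dfn_term_1 dfn_term_One dfn_term_Two dfn_term_Suc dfn_term_plus

lemma dfn_term_diff: "dfn_term s \<Longrightarrow> dfn_term t \<Longrightarrow> dfn_term (\<lambda>e. s e - t e)"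
proof (rule dfn_term_graph2[where F = "(-)"])
  fix i j k :: nat
  have "g (e i) - g (e j) = g (e k) \<longleftrightarrow>
      (g (e i) \<le> g (e j) \<and> g (e k) = 0) \<or> g (e j) + g (e k) = g (e i)" for e
    by auto
  then show "dfn (\<lambda>e. g (e i) - g (e j) = g (e k))"
    by (simp only:) (intro dfn_additive)
qed

end

locale arith_structure = additive_structure I CS C g
  for I :: "'r \<Rightarrow> 'a list \<Rightarrow> bool" and CS :: "'c set" and C :: "'c \<Rightarrow> 'a" and g +
  assumes dfn_g_times: "\<And>i j k. dfn (\<lambda>e. g (e i) * g (e j) = g (e k))"
begin

lemma dfn_term_times: "dfn_term s \<Longrightarrow> dfn_term t \<Longrightarrow> dfn_term (\<lambda>e. s e * t e)"
  by (rule dfn_term_graph2[where F = "(*)", OF dfn_g_times])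

lemmas dfn_arith = dfn_additive dfn_term_times

lemma dfn_term_mod: "dfn_term s \<Longrightarrow> dfn_term t \<Longrightarrow> dfn_term (\<lambda>e. s e mod t e)"
proof (rule dfn_term_graph2[where F = "(mod)"])
  fix i j k :: nat
  \<comment> \<open>Since \<open>x mod 0 = x\<close>, the divisor zero gets its own
    disjunct.\<close>
  have "g (e i) mod g (e j) = g (e k) \<longleftrightarrow> (g (e j) = 0 \<and> g (e i) = g (e k)) \<or>
      (g (e k) < g (e j) \<and> (\<exists>q. g (e i) = q * g (e j) + g (e k)))" for e
  proof (cases "g (e j) = 0")
    case False
    show ?thesis
    proof
      assume "g (e i) mod g (e j) = g (e k)"
      then show "(g (e j) = 0 \<and> g (e i) = g (e k)) \<or>
          (g (e k) < g (e j) \<and> (\<exists>q. g (e i) = q * g (e j) + g (e k)))"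
        using False by (metis div_mult_mod_eq mod_less_divisor neq0_conv)
    qed (use False in auto)
  qed auto
  then show "dfn (\<lambda>e. g (e i) mod g (e j) = g (e k))"
    by (simp only:) (intro dfn_arith)
qed

lemma dfn_term_beta:
  "dfn_term s \<Longrightarrow> dfn_term t \<Longrightarrow> dfn_term u \<Longrightarrow> dfn_term (\<lambda>e. beta (s e) (t e) (u e))"
  unfolding beta_def by (intro dfn_arith dfn_term_mod)

lemma dfn_term_if:
  assumes "dfn P" "dfn_term s" "dfn_term t"
  shows "dfn_term (\<lambda>e. if P e then s e else t e)"
proof -
  have "(if P e' then s e' else t e') = x \<longleftrightarrow> (P e' \<and> s e' = x) \<or> (\<not> P e' \<and> t e' = x)" for e' x
    by auto
  then show ?thesis
    unfolding dfn_term_def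
    by (simp only:) (intro dfn_arith dfn_rename[OF assms(1)] dfn_term_rename[OF assms(2)]
        dfn_term_rename[OF assms(3)])
qed

text \<open>The recursion is replaced by the existence of a beta code for the whole history of
  values, which turns an inductive definition into a first-order one.\<close>

lemma dfn_term_primrec:
  assumes 0: "\<And>e. F e 0 = A e" and Suc: "\<And>e k. F e (Suc k) = G e k (F e k)"
    and A: "dfn_term A"
    and G: "dfn_term (\<lambda>e. G (\<lambda>i. e (Suc (Suc i))) (g (e (Suc 0))) (g (e 0)))"
    and t: "dfn_term t"
  shows "dfn_term (\<lambda>e. F e (t e))"
proof (rule dfn_term_subst[OF _ t])
  have graph: "F e k = y \<longleftrightarrow> (\<exists>a b. beta a b 0 = A e \<and>
      (\<forall>i. i < k \<longrightarrow> beta a b (Suc i) = G e i (beta a b i)) \<and> beta a b k = y)" for e k y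
  proof
    assume y: "F e k = y"
    obtain a b where "\<forall>i<Suc k. beta a b i = F e i" using beta_surj by blast
    then show "\<exists>a b. beta a b 0 = A e \<and>
        (\<forall>i. i < k \<longrightarrow> beta a b (Suc i) = G e i (beta a b i)) \<and> beta a b k = y"
      using y by (intro exI[of _ a] exI[of _ b]) (auto simp: 0 Suc)
  next
    assume "\<exists>a b. beta a b 0 = A e \<and>
        (\<forall>i. i < k \<longrightarrow> beta a b (Suc i) = G e i (beta a b i)) \<and> beta a b k = y"
    then obtain a b where ab: "beta a b 0 = A e" "beta a b k = y"
      "\<And>i. i < k \<Longrightarrow> beta a b (Suc i) = G e i (beta a b i)" by blast
    \<comment> \<open>Any code obeying the recursion agrees with \<open>F e\<close> up to
      \<open>k\<close>, so the formula yields the same value whatever code is chosen.\<close>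
    have "i \<le> k \<Longrightarrow> beta a b i = F e i" for i
      by (induction i) (auto simp: ab 0 Suc)
    with ab(2) show "F e k = y" by simp
  qed
  have A': "dfn_term (\<lambda>e. A (\<lambda>i. e (h i)))" for h by (rule dfn_term_rename[OF A])
  have G': "dfn_term s \<Longrightarrow> dfn_term u \<Longrightarrow> dfn_term (\<lambda>e. G (\<lambda>i. e (h i)) (s e) (u e))" for h s u
  proof (rule dfn_term_subst2[where H = "\<lambda>e. G (\<lambda>i. e (h i))"])
    show "dfn_term (\<lambda>e. G (\<lambda>i. e (Suc (Suc (h i)))) (g (e (Suc 0))) (g (e 0)))"
      \<comment> \<open>Coordinates 0 and 1 carry the previous value and the counter and stay fixed;
        only the parameters behind them are renamed.\<close>
      using dfn_term_rename[OF G, of "case_nat 0 (case_nat 1 (\<lambda>i. Suc (Suc (h i))))"] by simp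
  qed
  show "dfn_term (\<lambda>e. F (\<lambda>i. e (Suc i)) (g (e 0)))"
    unfolding dfn_term_def graph by (intro dfn_arith dfn_term_beta A' G')
qed

lemma dfn_term_power:
  assumes s: "dfn_term s" and t: "dfn_term t" shows "dfn_term (\<lambda>e. s e ^ t e)"
  by (rule dfn_term_primrec[where A = "\<lambda>e. 1" and G = "\<lambda>e k x. s e * x", OF _ _ _ _ t])
    (simp_all add: dfn_term_1 dfn_term_times dfn_term_var dfn_term_rename[OF s])

lemma dfn_term_prod:
  assumes "dfn_term (\<lambda>e. s (\<lambda>i. e (Suc i)) (g (e 0)))" "dfn_term t"
  shows "dfn_term (\<lambda>e. \<Prod>i<t e. s e i)"
proof (rule dfn_term_primrec[where F = "\<lambda>e k. \<Prod>i<k. s e i" and A = "\<lambda>e. 1" and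
      G = "\<lambda>e k x. x * s e k"])
  show "dfn_term (\<lambda>e. g (e 0) * s (\<lambda>i. e (Suc (Suc i))) (g (e (Suc 0))))"
    using dfn_term_rename[OF assms(1), of Suc] by (intro dfn_arith)
qed (simp_all add: dfn_term_1 assms)

lemma dfn_prime:
  assumes s: "dfn_term s" shows "dfn (\<lambda>e. prime (s e))"
  unfolding prime_nat_iff dvd_def by (intro dfn_arith s dfn_term_rename[OF s])

text \<open>The primes arise by primitive recursion with "least prime above" as step. The recursion
  starts from 2 and runs for \<open>s e - 1\<close> steps; truncated subtraction makes this agree
  with \<open>nth_prime\<close> at 0 too.\<close>

lemma dfn_term_nth_prime:
  assumes "dfn_term s" shows "dfn_term (\<lambda>e. nth_prime (s e))"
proof -
  define q where "q = (\<lambda>k. enumerate {p :: nat. prime p} k)"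
  have q0: "q 0 = 2" unfolding q_def enumerate_0
    by (rule Least_equality) (auto simp: prime_ge_2_nat)
  have qSuc: "q (Suc k) = (LEAST p. prime p \<and> q k < p)" for k
    unfolding q_def using enumerate_Suc''[OF primes_infinite, of k] by simp
  have ex: "\<exists>p. prime p \<and> (m::nat) < p" for m using bigger_prime by blast
  have least: "(LEAST p. prime p \<and> m < p) = x \<longleftrightarrow>
      prime x \<and> m < x \<and> (\<forall>z. prime z \<and> m < z \<longrightarrow> x \<le> z)" for m x :: nat
  proof
    assume "(LEAST p. prime p \<and> m < p) = x"
    then show "prime x \<and> m < x \<and> (\<forall>z. prime z \<and> m < z \<longrightarrow> x \<le> z)"
      using LeastI_ex[OF ex] Least_le[of "\<lambda>p. prime p \<and> m < p"] by blast
  qed (auto intro: Least_equality)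
  have next_prime: "dfn_term (\<lambda>e. LEAST p. prime p \<and> g (e 0) < p)"
    unfolding dfn_term_def least by (intro dfn_arith dfn_prime)
  have "dfn_term (\<lambda>e. q (s e - 1))"
    by (rule dfn_term_primrec[where A = "\<lambda>e. 2" and G = "\<lambda>e k x. LEAST p. prime p \<and> x < p",
        OF q0 qSuc dfn_term_Two next_prime dfn_term_diff[OF assms dfn_term_One]])
  then show ?thesis by (simp add: nth_prime_def q_def)
qed

lemma dfn_term_code_val:
  assumes s: "dfn_term (\<lambda>e. s (\<lambda>i. e (Suc i)) (g (e 0)))" and t: "dfn_term t"
  shows "dfn_term (\<lambda>e. code_val (s e) (t e))"
  unfolding code_val_def
  by (intro dfn_term_if dfn_arith dfn_term_power dfn_term_prod dfn_term_nth_prime dfn_term_diff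
      s t dfn_term_rename[OF t])

end

section \<open>Partitions as antitone functions\<close>

text \<open>Padding with zeros absorbs the length condition of \<open>young_le\<close>; as parts are
  positive, the length is recovered as the position of the first zero.\<close>

definition pt :: "partition \<Rightarrow> nat \<Rightarrow> nat" where
  "pt \<sigma> i = (if i < length (parts \<sigma>) then parts \<sigma> ! i else 0)"

abbreviation len :: "partition \<Rightarrow> nat" where
  "len \<sigma> \<equiv> length (parts \<sigma>)"

lemma parts_sorted: "sorted_wrt (\<ge>) (parts \<sigma>)" and parts_pos: "x \<in> set (parts \<sigma>) \<Longrightarrow> 0 < x"
  using Rep_partition[of \<sigma>] by (auto simp: parts_def)

lemma parts_inject: "parts \<sigma> = parts \<tau> \<Longrightarrow> \<sigma> = \<tau>"
  by (simp add: parts_def Rep_partition_inject)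

lemma ex_parts: "sorted_wrt (\<ge>) xs \<Longrightarrow> \<forall>x\<in>set xs. 0 < x \<Longrightarrow> \<exists>\<sigma>. parts \<sigma> = xs"
  unfolding parts_def by (rule exI[of _ "Abs_partition xs"]) (simp add: Abs_partition_inverse)

lemma pt_antimono: "i \<le> j \<Longrightarrow> pt \<sigma> j \<le> pt \<sigma> i"
  using sorted_wrt_nth_less[OF parts_sorted[of \<sigma>], of i j]
  by (cases "i = j") (auto simp: pt_def)

lemma pt_pos_iff: "0 < pt \<sigma> i \<longleftrightarrow> i < len \<sigma>"
  using parts_pos[of "parts \<sigma> ! i" \<sigma>] by (auto simp: pt_def)

lemma pt_eq_0_iff: "pt \<sigma> i = 0 \<longleftrightarrow> len \<sigma> \<le> i"
  using pt_pos_iff[of \<sigma> i] by auto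

lemma young_le_iff: "young_le \<sigma> \<tau> \<longleftrightarrow> (\<forall>i. pt \<sigma> i \<le> pt \<tau> i)"
proof
  assume "young_le \<sigma> \<tau>"
  then show "\<forall>i. pt \<sigma> i \<le> pt \<tau> i" by (auto simp: young_le_def pt_def)
next
  assume *: "\<forall>i. pt \<sigma> i \<le> pt \<tau> i"
  have le: "len \<sigma> \<le> len \<tau>" using *[rule_format, of "len \<tau>"] by (simp add: pt_eq_0_iff[symmetric] pt_def)
  have "parts \<sigma> ! i \<le> parts \<tau> ! i" if "i < len \<sigma>" for i
    using *[rule_format, of i] that le by (simp add: pt_def)
  with le show "young_le \<sigma> \<tau>" by (simp add: young_le_def)
qed

lemma ex_partition_prefix:
  assumes "\<And>i. i < l \<Longrightarrow> 0 < s i" "\<And>i j. i < j \<Longrightarrow> j < l \<Longrightarrow> s j \<le> s i"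
  shows "\<exists>\<sigma>. len \<sigma> = l \<and> (\<forall>i<l. pt \<sigma> i = s i)"
proof -
  have "\<exists>\<sigma>. parts \<sigma> = map s [0..<l]"
    by (rule ex_parts) (use assms in \<open>auto simp: sorted_wrt_iff_nth_less\<close>)
  then obtain \<sigma> where "parts \<sigma> = map s [0..<l]" by blast
  then show ?thesis by (intro exI[of _ \<sigma>]) (simp add: pt_def)
qed

lemma ex_partition:
  assumes "antimono s" "s n = (0 :: nat)"
  shows "\<exists>\<sigma>. \<forall>i. pt \<sigma> i = s i"
proof -
  \<comment> \<open>The parts end at the first zero of \<open>s\<close>; antitonicity keeps all
    later values zero.\<close>
  define l where "l = (LEAST i. s i = 0)"
  have l: "s l = 0" unfolding l_def using assms(2) by (rule LeastI)
  have "0 < s i" if "i < l" for i using not_less_Least[of i "\<lambda>i. s i = 0"] that by (auto simp: l_def)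
  then obtain \<sigma> where \<sigma>: "len \<sigma> = l" "\<forall>i<l. pt \<sigma> i = s i"
    using ex_partition_prefix[of l s] assms(1) by (auto simp: antimono_def)
  have "pt \<sigma> i = s i" if "\<not> i < l" for i
  proof -
    have "s i \<le> s l" using assms(1) that by (simp add: antimono_def)
    then show ?thesis using that \<sigma>(1) l by (simp add: pt_def)
  qed
  with \<sigma>(2) show ?thesis by blast
qed

lemma ex_rectangle: "\<exists>\<sigma>. \<forall>i. pt \<sigma> i = (if i < m then n else 0)"
  by (rule ex_partition[where n = m]) (auto simp: antimono_def)

section \<open>The coding bijection\<close>

text \<open>The coding without its exceptional cases: a bijection from partitions onto the positive
  numbers. \<open>num\<close> departs from it only at partitions into ones, where the exponent drops
  by one, and at the empty partition, which goes to 0.\<close>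

definition parts_prod :: "partition \<Rightarrow> nat" where
  "parts_prod \<sigma> = prod_list (map nth_prime (parts \<sigma>))"

lemma prime_nth_prime: "prime (nth_prime n)"
  using enumerate_in_set[OF primes_infinite, of "n - 1"] by (simp add: nth_prime_def)

lemma nth_prime_inj: "inj_on nth_prime {0<..}"
proof (rule inj_onI)
  fix x y assume "x \<in> {0<..}" "y \<in> {0<..}" "nth_prime x = nth_prime y"
  then have "x - 1 = y - 1"
    using inj_enumerate[OF primes_infinite] by (auto simp: nth_prime_def dest: injD)
  with \<open>x \<in> _\<close> \<open>y \<in> _\<close> show "x = y" by simp
qed

lemma nth_prime_range: "prime p \<Longrightarrow> \<exists>n>0. nth_prime n = p"
proof -
  assume "prime p"
  then obtain k where "enumerate {p. prime p} k = p"
    using enumerate_Ex[of "{p. prime p}" p] primes_infinite by auto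
  then show ?thesis by (intro exI[of _ "Suc k"]) (simp add: nth_prime_def)
qed

lemma nth_prime_1: "nth_prime (Suc 0) = 2"
  unfolding nth_prime_def diff_Suc_1 enumerate_0
  by (rule Least_equality) (auto simp: prime_ge_2_nat)

lemma parts_prod_pos: "0 < parts_prod \<sigma>"
  using prime_nth_prime by (auto simp: parts_prod_def prod_list_zero_iff intro!: Nat.gr0I) (metis not_prime_0)

text \<open>Unique factorisation recovers the multiset of parts, and a partition is determined by
  that multiset because its parts are sorted.\<close>

lemma inj_parts_prod: "inj parts_prod"
proof (rule injI)
  fix \<sigma> \<tau> assume eq: "parts_prod \<sigma> = parts_prod \<tau>"
  have pf: "prime_factorization (parts_prod \<rho>) = image_mset nth_prime (mset (parts \<rho>))" for \<rho>
    unfolding parts_prod_def prod_mset_prod_list[symmetric] mset_map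
    by (rule prime_factorization_prod_mset_primes) (auto intro: prime_nth_prime)
  have "image_mset (inv_into {0<..} nth_prime) (prime_factorization (parts_prod \<rho>)) = mset (parts \<rho>)" for \<rho>
  proof -
    have "inv_into {0<..} nth_prime (nth_prime x) = x" if "x \<in># mset (parts \<rho>)" for x
      using that parts_pos by (intro inv_into_f_f[OF nth_prime_inj]) auto
    then have "image_mset (\<lambda>x. inv_into {0<..} nth_prime (nth_prime x)) (mset (parts \<rho>)) =
        image_mset (\<lambda>x. x) (mset (parts \<rho>))" by (rule image_mset_cong)
    then show ?thesis unfolding pf multiset.map_comp comp_def by simp
  qed
  then have "mset (rev (parts \<sigma>)) = mset (rev (parts \<tau>))" using eq by (metis mset_rev)
  moreover have "sorted (rev (parts \<rho>))" for \<rho>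
    using parts_sorted[of \<rho>] by (simp add: sorted_wrt_rev)
  ultimately have "rev (parts \<sigma>) = rev (parts \<tau>)"
    by (metis properties_for_sort sorted_sort_id)
  then show "\<sigma> = \<tau>" by (intro parts_inject) simp
qed

lemma surj_parts_prod: "0 < n \<Longrightarrow> \<exists>\<sigma>. parts_prod \<sigma> = n"
proof -
  assume n: "0 < n"
  define idx where "idx = (\<lambda>p. SOME k. k > 0 \<and> nth_prime k = p)"
  have idx: "idx p > 0" "nth_prime (idx p) = p" if "prime p" for p
    using someI_ex[OF nth_prime_range[OF that]] by (auto simp: idx_def)
  define M where "M = image_mset idx (prime_factorization n)"
  have "\<exists>\<sigma>. parts \<sigma> = rev (sorted_list_of_multiset M)"
    by (rule ex_parts) (auto simp: sorted_wrt_rev M_def idx in_prime_factors_iff)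
  then obtain \<sigma> where \<sigma>: "parts \<sigma> = rev (sorted_list_of_multiset M)" by blast
  have "parts_prod \<sigma> = prod_mset (image_mset nth_prime M)"
    unfolding parts_prod_def \<sigma> prod_mset_prod_list[symmetric] by simp
  also have "image_mset nth_prime M = prime_factorization n"
  proof -
    have "image_mset (\<lambda>p. nth_prime (idx p)) (prime_factorization n) = image_mset (\<lambda>p. p) (prime_factorization n)"
      by (rule image_mset_cong) (auto simp: idx in_prime_factors_iff)
    then show ?thesis by (simp add: M_def multiset.map_comp comp_def)
  qed
  also have "prod_mset (prime_factorization n) = n" using n by (simp add: prod_mset_prime_factorization_nat)
  finally show ?thesis by blast
qed

lemma ones_iff: "(\<forall>x\<in>set (parts \<sigma>). x = 1) \<longleftrightarrow> parts \<sigma> = replicate (len \<sigma>) 1"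
  by (metis in_set_replicate replicate_length_same)

lemma ex_ones: "\<exists>\<sigma>. parts \<sigma> = replicate k 1"
  by (rule ex_parts) (auto simp: sorted_wrt_iff_nth_less)

text \<open>The partition into \<open>k\<close> ones already has product \<open>2 ^ k\<close>, and
  injectivity leaves room for no other.\<close>

lemma parts_prod_power_2_iff: "(\<exists>k. parts_prod \<sigma> = 2 ^ k) \<longleftrightarrow> (\<forall>x\<in>set (parts \<sigma>). x = 1)"
proof
  assume "\<exists>k. parts_prod \<sigma> = 2 ^ k"
  then obtain k where k: "parts_prod \<sigma> = 2 ^ k" by blast
  obtain \<tau> where \<tau>: "parts \<tau> = replicate k 1" using ex_ones by blast
  with k have "parts_prod \<sigma> = parts_prod \<tau>" by (simp add: parts_prod_def nth_prime_1)
  then have "\<sigma> = \<tau>" using inj_parts_prod by (auto dest: injD)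
  with \<tau> show "\<forall>x\<in>set (parts \<sigma>). x = 1" by simp
next
  assume "\<forall>x\<in>set (parts \<sigma>). x = 1"
  then have "parts \<sigma> = replicate (len \<sigma>) 1" using ones_iff by blast
  then have "parts_prod \<sigma> = 2 ^ len \<sigma>"
    using nth_prime_1 prod_list_replicate[of "len \<sigma>" "2::nat"]
    by (metis One_nat_def map_replicate parts_prod_def)
  then show "\<exists>k. parts_prod \<sigma> = 2 ^ k" by blast
qed

text \<open>The three cases take values in disjoint sets: 0, the powers of two, and the remaining
  positive numbers. Injectivity of \<open>num\<close> can thus be checked case by case.\<close>

lemma num_cases:
  obtains "parts \<sigma> = []" "num \<sigma> = 0"
  | k where "parts \<sigma> = replicate (Suc k) 1" "num \<sigma> = 2 ^ k"
  | "\<forall>k. parts_prod \<sigma> \<noteq> 2 ^ k" "num \<sigma> = parts_prod \<sigma>"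
proof (cases "parts \<sigma> = []")
  case True
  then show ?thesis using that(1) by (simp add: num_def)
next
  case False
  then obtain k where k: "len \<sigma> = Suc k" by (cases "len \<sigma>") auto
  show ?thesis
  proof (cases "\<forall>x\<in>set (parts \<sigma>). x = 1")
    case True
    then have "parts \<sigma> = replicate (Suc k) 1" using k ones_iff[of \<sigma>] by metis
    with that(2)[of k] show ?thesis by (simp add: num_def)
  next
    case F: False
    have "num \<sigma> = parts_prod \<sigma>" unfolding num_def parts_prod_def Let_def using F False by (simp only: if_False)
    with F show ?thesis using that(3) parts_prod_power_2_iff[of \<sigma>] by blast
  qed
qed

lemma inj_num: "inj num"
proof (rule injI)
  fix \<sigma> \<tau> assume eq: "num \<sigma> = num \<tau>"
  show "\<sigma> = \<tau>"
  proof (cases \<sigma> rule: num_cases)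
    case 1
    then show ?thesis
      by (cases \<tau> rule: num_cases) (use eq parts_prod_pos[of \<tau>] in \<open>auto intro!: parts_inject\<close>)
  next
    case (2 k)
    then show ?thesis
      by (cases \<tau> rule: num_cases) (use eq in \<open>auto intro!: parts_inject\<close>)
  next
    case 3
    show ?thesis
    proof (cases \<tau> rule: num_cases)
      case 1 then show ?thesis using 3 eq parts_prod_pos[of \<sigma>] by simp
    next
      case (2 k)
      then have "parts_prod \<sigma> = 2 ^ k" using 3(2) eq by simp
      with 3(1) show ?thesis by blast
    next
      case t: 3
      then have "parts_prod \<sigma> = parts_prod \<tau>" using 3(2) eq by simp
      then show ?thesis by (rule injD[OF inj_parts_prod])
    qed
  qed
qed

lemma surj_num: "surj num"
proof -
  have "\<exists>\<sigma>. num \<sigma> = n" for n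
  proof -
    consider "n = 0" | k where "n = 2 ^ k" | "n > 0" "\<forall>k. n \<noteq> 2 ^ k" by blast
    then show ?thesis
    proof cases
      case 1
      obtain \<sigma> where "parts \<sigma> = []" using ex_ones[of 0] by auto
      with 1 show ?thesis by (intro exI[of _ \<sigma>]) (simp add: num_def)
    next
      case 2
      obtain \<sigma> where "parts \<sigma> = replicate (Suc k) 1" using ex_ones by blast
      with 2 show ?thesis by (intro exI[of _ \<sigma>]) (simp add: num_def)
    next
      case 3
      obtain \<sigma> where \<sigma>: "parts_prod \<sigma> = n" using surj_parts_prod 3 by blast
      with 3 have "\<not> (\<forall>x\<in>set (parts \<sigma>). x = 1)" using parts_prod_power_2_iff[of \<sigma>] by blast
      moreover from this have "parts \<sigma> \<noteq> []" by auto
      ultimately have "num \<sigma> = n" using \<sigma> by (auto simp: num_def parts_prod_def Let_def)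
      then show ?thesis by blast
    qed
  qed
  then show ?thesis by (metis surjI)
qed

lemma num_code_val: "num \<sigma> = code_val (pt \<sigma>) (len \<sigma>)"
proof -
  have "prod_list (map nth_prime (parts \<sigma>)) = (\<Prod>i<len \<sigma>. nth_prime (pt \<sigma> i))"
    by (subst prod.list_conv_set_nth) (auto simp: pt_def atLeast0LessThan)
  moreover have "(\<forall>x\<in>set (parts \<sigma>). x = 1) \<longleftrightarrow> (\<forall>i. i < len \<sigma> \<longrightarrow> pt \<sigma> i = 1)"
    by (auto simp: all_set_conv_all_nth pt_def)
  moreover have "parts \<sigma> = [] \<longleftrightarrow> len \<sigma> = 0" by simp
  ultimately show ?thesis unfolding num_def code_val_def Let_def by (simp only:)
qed

section \<open>The two structures\<close>

interpretation Ar: arith_structure arith_rel "{} :: unit set" no_cst num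
proof unfold_locales
  interpret fo_structure arith_rel "{} :: unit set" no_cst .
  show "surj num" by (rule surj_num)
  show "dfn (\<lambda>e. num (e i) = num (e j))" for i j
    using dfn_eq[of i j] by (simp add: inj_eq[OF inj_num])
  show "dfn (\<lambda>e. num (e i) + num (e j) = num (e k))" for i j k
    by (rule dfnI[of "FRel True [Var i, Var j, Var k]"]) (auto simp: plus_rel_def)
  show "dfn (\<lambda>e. num (e i) * num (e j) = num (e k))" for i j k
    by (rule dfnI[of "FRel False [Var i, Var j, Var k]"]) (auto simp: times_rel_def)
qed

text \<open>Says in terms of numbers alone that \<open>a\<close> and \<open>b\<close> encode the
  \<open>l\<close> parts of a partition with code \<open>x\<close>.\<close>

definition codes :: "nat \<Rightarrow> nat \<Rightarrow> nat \<Rightarrow> nat \<Rightarrow> bool" where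
  "codes a b l x \<longleftrightarrow> (\<forall>i. i < l \<longrightarrow> 0 < beta a b i) \<and>
     (\<forall>i j. i < j \<and> j < l \<longrightarrow> beta a b j \<le> beta a b i) \<and> code_val (beta a b) l = x"

lemma code_val_cong: "(\<And>i. i < l \<Longrightarrow> s i = t i) \<Longrightarrow> code_val s l = code_val t l"
  unfolding code_val_def by (intro if_cong prod.cong refl) auto

text \<open>A positive antitone coded sequence lists the parts of some partition; if that partition
  has the code of \<open>\<sigma>\<close>, injectivity of \<open>num\<close> makes it
  \<open>\<sigma>\<close>.\<close>

lemma codes_num_iff: "codes a b l (num \<sigma>) \<longleftrightarrow> l = len \<sigma> \<and> (\<forall>i<l. beta a b i = pt \<sigma> i)"
proof
  assume c: "codes a b l (num \<sigma>)"
  then obtain \<tau> where \<tau>: "len \<tau> = l" "\<forall>i<l. pt \<tau> i = beta a b i"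
    using ex_partition_prefix[of l "beta a b"] unfolding codes_def by blast
  then have "num \<tau> = code_val (beta a b) l"
    unfolding num_code_val \<tau>(1) by (intro code_val_cong) simp
  with c have "\<tau> = \<sigma>" using inj_num by (auto simp: codes_def dest: injD)
  with \<tau> show "l = len \<sigma> \<and> (\<forall>i<l. beta a b i = pt \<sigma> i)" by auto
next
  assume *: "l = len \<sigma> \<and> (\<forall>i<l. beta a b i = pt \<sigma> i)"
  then have "code_val (beta a b) l = num \<sigma>"
    unfolding num_code_val by (auto intro: code_val_cong)
  with * show "codes a b l (num \<sigma>)"
    by (auto simp: codes_def pt_pos_iff intro: pt_antimono)
qed

lemma Ar_dfn_codes: "Ar.dfn (\<lambda>e. codes (num (e i)) (num (e j)) (num (e k)) (num (e m)))"
  unfolding codes_def by (intro Ar.dfn_arith Ar.dfn_term_beta Ar.dfn_term_code_val)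

lemma young_le_codes_iff: "young_le \<sigma> \<tau> \<longleftrightarrow>
  (\<exists>a b l a' b' l'. codes a b l (num \<sigma>) \<and> codes a' b' l' (num \<tau>) \<and> l \<le> l' \<and>
     (\<forall>i. i < l \<longrightarrow> beta a b i \<le> beta a' b' i))"
proof
  assume le: "young_le \<sigma> \<tau>"
  obtain a b where ab: "\<forall>i<len \<sigma>. beta a b i = pt \<sigma> i" using beta_surj by blast
  obtain a' b' where ab': "\<forall>i<len \<tau>. beta a' b' i = pt \<tau> i" using beta_surj by blast
  have "codes a b (len \<sigma>) (num \<sigma>)" "codes a' b' (len \<tau>) (num \<tau>)"
    using ab ab' by (simp_all add: codes_num_iff)
  moreover have "len \<sigma> \<le> len \<tau>" using le by (simp add: young_le_def)
  moreover have "\<forall>i. i < len \<sigma> \<longrightarrow> beta a b i \<le> beta a' b' i"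
    using le ab ab' calculation(3) by (simp add: young_le_iff)
  ultimately show "\<exists>a b l a' b' l'. codes a b l (num \<sigma>) \<and> codes a' b' l' (num \<tau>) \<and> l \<le> l' \<and>
     (\<forall>i. i < l \<longrightarrow> beta a b i \<le> beta a' b' i)" by blast
next
  assume "\<exists>a b l a' b' l'. codes a b l (num \<sigma>) \<and> codes a' b' l' (num \<tau>) \<and> l \<le> l' \<and>
     (\<forall>i. i < l \<longrightarrow> beta a b i \<le> beta a' b' i)"
  then show "young_le \<sigma> \<tau>"
    unfolding codes_num_iff by (auto simp: young_le_def pt_def)
qed

lemma Ar_dfn_young_le: "Ar.dfn (\<lambda>e. young_le (e i) (e j))"
  unfolding young_le_codes_iff by (intro Ar.dfn_arith Ar_dfn_codes Ar.dfn_term_beta)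

lemma parts_two_ones: "parts two_ones = [1, 1]"
  unfolding parts_def two_ones_def by (rule Abs_partition_inverse) simp

text \<open>The constant consists of ones only, so its code is
  \<open>2 ^ (2 - 1) = 2\<close>.\<close>

lemma Ar_dfn_two_ones: "Ar.dfn (\<lambda>e. e i = two_ones)"
proof -
  have "num two_ones = 2" by (simp add: num_def parts_two_ones)
  then have "e i = two_ones \<longleftrightarrow> num (e i) = 2" for e :: "nat \<Rightarrow> partition"
    using inj_num by (metis injD)
  then show ?thesis by (simp only:) (intro Ar.dfn_arith)
qed

section \<open>First parts, lengths and rows in Young's lattice\<close>

interpretation Y: fo_structure Ystar_rel "UNIV :: unit set" Ystar_cst .

lemma Y_dfn_young_le: "Y.dfn (\<lambda>e. young_le (e i) (e j))"
  by (rule Y.dfnI[of "FRel () [Var i, Var j]"]) auto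

lemma Y_dfn_two_ones: "Y.dfn (\<lambda>e. e i = two_ones)"
  using Y.dfn_const[of "()" i] by (simp add: Ystar_cst_def)

text \<open>The negation singles out the partitions with at most one row.\<close>

lemma two_ones_le_iff: "young_le two_ones \<sigma> \<longleftrightarrow> pt \<sigma> (Suc 0) \<noteq> 0"
proof -
  have "pt two_ones i = (if i < 2 then 1 else 0)" for i
    by (auto simp: pt_def parts_two_ones less_2_cases_iff)
  then show ?thesis
    using pt_antimono[of 0 "Suc 0" \<sigma>] by (auto simp: young_le_iff less_2_cases_iff)
qed

lemma ex_first: "\<exists>\<sigma>. pt \<sigma> 0 = n"
  using ex_rectangle[of 1 n] by (metis less_one)

lemma ex_len: "\<exists>\<sigma>. len \<sigma> = n"
proof -
  obtain \<sigma> where \<sigma>: "\<forall>i. pt \<sigma> i = (if i < n then 1 else 0)" using ex_rectangle by blast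
  then have "i < len \<sigma> \<longleftrightarrow> i < n" for i using pt_pos_iff[of \<sigma> i] by (auto split: if_splits)
  then have "len \<sigma> = n" by (metis linorder_neqE_nat less_irrefl)
  then show ?thesis by blast
qed

text \<open>A partition with at most one row lies below \<open>\<sigma>\<close> exactly if that row
  is no longer than the first part of \<open>\<sigma>\<close>; comparing the sets of such partitions
  compares first parts.\<close>

lemma first_le_iff: "pt \<sigma> 0 \<le> pt \<tau> 0 \<longleftrightarrow>
  (\<forall>\<rho>. \<not> young_le two_ones \<rho> \<and> young_le \<rho> \<sigma> \<longrightarrow> young_le \<rho> \<tau>)"
proof
  assume le: "pt \<sigma> 0 \<le> pt \<tau> 0"
  show "\<forall>\<rho>. \<not> young_le two_ones \<rho> \<and> young_le \<rho> \<sigma> \<longrightarrow> young_le \<rho> \<tau>"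
  proof (intro allI impI)
    fix \<rho> assume \<rho>: "\<not> young_le two_ones \<rho> \<and> young_le \<rho> \<sigma>"
    have "pt \<rho> i \<le> pt \<tau> i" for i
    proof (cases "i = 0")
      case True
      have "pt \<rho> 0 \<le> pt \<sigma> 0" using \<rho> young_le_iff by blast
      with le True show ?thesis by simp
    next
      case False
      have "pt \<rho> (Suc 0) = 0" using \<rho> two_ones_le_iff by blast
      with False show ?thesis using pt_antimono[of "Suc 0" i \<rho>] by simp
    qed
    then show "young_le \<rho> \<tau>" by (simp add: young_le_iff)
  qed
next
  assume *: "\<forall>\<rho>. \<not> young_le two_ones \<rho> \<and> young_le \<rho> \<sigma> \<longrightarrow> young_le \<rho> \<tau>"
  obtain \<rho> where \<rho>: "\<forall>i. pt \<rho> i = (if i < 1 then pt \<sigma> 0 else 0)" using ex_rectangle by blast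
  then have "\<not> young_le two_ones \<rho>" "young_le \<rho> \<sigma>"
    unfolding two_ones_le_iff by (auto simp: young_le_iff)
  then have "young_le \<rho> \<tau>" using * by blast
  then have "pt \<rho> 0 \<le> pt \<tau> 0" by (simp add: young_le_iff)
  with \<rho> show "pt \<sigma> 0 \<le> pt \<tau> 0" by simp
qed

lemma Y_dfn_first_le: "Y.dfn (\<lambda>e. pt (e i) 0 \<le> pt (e j) 0)"
proof -
  have "Y.dfn (\<lambda>e. young_le two_ones (e i))" for i
    by (rule Y.dfn_subst_elem[where R = "\<lambda>e x. young_le x (e i)"])
      (intro Y_dfn_young_le Y_dfn_two_ones)+
  then show ?thesis unfolding first_le_iff by (intro Y.dfn_logic Y_dfn_young_le)
qed

text \<open>Dual to \<open>first_le_iff\<close>: the first part of \<open>two_ones\<close> is 1, so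
  \<open>\<rho>\<close> ranges over the partitions with at most one column.\<close>

lemma len_le_iff: "len \<sigma> \<le> len \<tau> \<longleftrightarrow>
  (\<forall>\<rho>. pt \<rho> 0 \<le> pt two_ones 0 \<and> young_le \<rho> \<sigma> \<longrightarrow> young_le \<rho> \<tau>)"
proof
  assume le: "len \<sigma> \<le> len \<tau>"
  show "\<forall>\<rho>. pt \<rho> 0 \<le> pt two_ones 0 \<and> young_le \<rho> \<sigma> \<longrightarrow> young_le \<rho> \<tau>"
  proof (intro allI impI)
    fix \<rho> assume \<rho>: "pt \<rho> 0 \<le> pt two_ones 0 \<and> young_le \<rho> \<sigma>"
    have "pt \<rho> i \<le> pt \<tau> i" for i
    proof (cases "pt \<rho> i = 0")
      case False
      have "pt \<rho> i \<le> 1" using \<rho> pt_antimono[of 0 i \<rho>] by (simp add: pt_def[of two_ones] parts_two_ones)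
      moreover have "pt \<sigma> i \<noteq> 0" using False \<rho> unfolding young_le_iff by (metis le_zero_eq)
      ultimately show ?thesis using le pt_pos_iff[of \<sigma> i] pt_pos_iff[of \<tau> i] by linarith
    qed simp
    then show "young_le \<rho> \<tau>" by (simp add: young_le_iff)
  qed
next
  assume *: "\<forall>\<rho>. pt \<rho> 0 \<le> pt two_ones 0 \<and> young_le \<rho> \<sigma> \<longrightarrow> young_le \<rho> \<tau>"
  obtain \<rho> where \<rho>: "\<forall>i. pt \<rho> i = (if i < len \<sigma> then 1 else 0)" using ex_rectangle by blast
  have "young_le \<rho> \<sigma>" unfolding young_le_iff using \<rho> pt_pos_iff[of \<sigma>] by (simp add: Suc_le_eq)
  then have "young_le \<rho> \<tau>" using * \<rho> by (simp add: pt_def[of two_ones] parts_two_ones)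
  then have "pt \<rho> (len \<tau>) = 0" unfolding young_le_iff using pt_eq_0_iff[of \<tau> "len \<tau>"] by (metis le_zero_eq order_refl)
  with \<rho> show "len \<sigma> \<le> len \<tau>" by (auto split: if_splits)
qed

lemma Y_dfn_len_le: "Y.dfn (\<lambda>e. len (e i) \<le> len (e j))"
proof -
  have "Y.dfn (\<lambda>e. pt (e i) 0 \<le> pt two_ones 0)" for i
    by (rule Y.dfn_subst_elem[where R = "\<lambda>e x. pt (e i) 0 \<le> pt x 0"])
      (intro Y_dfn_first_le Y_dfn_two_ones)+
  then show ?thesis unfolding len_le_iff by (intro Y.dfn_logic Y_dfn_young_le)
qed

lemma Y_dfn_first_eq: "Y.dfn (\<lambda>e. pt (e i) 0 = pt (e j) 0)"
  unfolding order_eq_iff by (intro Y.dfn_logic Y_dfn_first_le)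

lemma Y_dfn_first_less: "Y.dfn (\<lambda>e. pt (e i) 0 < pt (e j) 0)"
  unfolding not_le[symmetric] by (intro Y.dfn_logic Y_dfn_first_le)

lemma Y_dfn_len_eq: "Y.dfn (\<lambda>e. len (e i) = len (e j))"
  unfolding order_eq_iff by (intro Y.dfn_logic Y_dfn_len_le)

lemma Y_dfn_len_less: "Y.dfn (\<lambda>e. len (e i) < len (e j))"
  unfolding not_le[symmetric] by (intro Y.dfn_logic Y_dfn_len_le)

lemmas Y_dfn = Y.dfn_logic Y_dfn_young_le Y_dfn_first_le Y_dfn_first_eq Y_dfn_first_less
  Y_dfn_len_le Y_dfn_len_eq Y_dfn_len_less

text \<open>The rectangle with \<open>m\<close> rows of length \<open>n\<close> is the largest partition with at most \<open>m\<close> rows and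
  first row at most \<open>n\<close>.\<close>
lemma rectangle_le_iff:
  "(\<forall>\<rho>. pt \<rho> 0 \<le> n \<and> len \<rho> \<le> m \<longrightarrow> young_le \<rho> \<sigma>) \<longleftrightarrow> m = 0 \<or> n \<le> pt \<sigma> (m - 1)"
proof
  assume *: "\<forall>\<rho>. pt \<rho> 0 \<le> n \<and> len \<rho> \<le> m \<longrightarrow> young_le \<rho> \<sigma>"
  obtain \<rho> where \<rho>: "\<forall>i. pt \<rho> i = (if i < m then n else 0)" using ex_rectangle by blast
  then have "len \<rho> \<le> m" using pt_eq_0_iff[of \<rho> m] by simp
  with * \<rho> have "young_le \<rho> \<sigma>" by simp
  then have "pt \<rho> (m - 1) \<le> pt \<sigma> (m - 1)" by (simp add: young_le_iff)
  with \<rho> show "m = 0 \<or> n \<le> pt \<sigma> (m - 1)" by (cases "m = 0") simp_all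
next
  assume *: "m = 0 \<or> n \<le> pt \<sigma> (m - 1)"
  show "\<forall>\<rho>. pt \<rho> 0 \<le> n \<and> len \<rho> \<le> m \<longrightarrow> young_le \<rho> \<sigma>"
  proof (intro allI impI)
    fix \<rho> assume \<rho>: "pt \<rho> 0 \<le> n \<and> len \<rho> \<le> m"
    have "pt \<rho> i \<le> pt \<sigma> i" for i
    proof (cases "pt \<rho> i = 0")
      case False
      then have "i < m" using pt_pos_iff[of \<rho> i] \<rho> by simp
      then have "n \<le> pt \<sigma> i" using * pt_antimono[of i "m - 1" \<sigma>] by linarith
      then show ?thesis using \<rho> pt_antimono[of 0 i \<rho>] by simp
    qed simp
    then show "young_le \<rho> \<sigma>" by (simp add: young_le_iff)
  qed
qed

text \<open>The row index is given one-based by the length of \<open>c\<close>, the value by the first part of \<open>r\<close>.\<close>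
definition val :: "partition \<Rightarrow> partition \<Rightarrow> partition \<Rightarrow> bool" where
  "val \<sigma> c r \<longleftrightarrow> len c \<noteq> 0 \<and> pt \<sigma> (len c - 1) = pt r 0"

text \<open>By \<open>rectangle_le_iff\<close>, the row in question is the width of the widest
  rectangle with \<open>len c\<close> rows below \<open>\<sigma>\<close>. The first conjunct
  expresses that \<open>len c\<close> is positive, the last that the width is maximal.\<close>

lemma Y_dfn_val: "Y.dfn (\<lambda>e. val (e k) (e i) (e j))"
proof -
  have "val \<sigma> c r \<longleftrightarrow> (\<exists>\<rho>. len \<rho> < len c) \<and>
      (\<forall>\<rho>. pt \<rho> 0 \<le> pt r 0 \<and> len \<rho> \<le> len c \<longrightarrow> young_le \<rho> \<sigma>) \<and>
      (\<forall>s. (\<forall>\<rho>. pt \<rho> 0 \<le> pt s 0 \<and> len \<rho> \<le> len c \<longrightarrow> young_le \<rho> \<sigma>) \<longrightarrow> pt s 0 \<le> pt r 0)" for \<sigma> c r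
  proof -
    have "(\<exists>\<rho>. len \<rho> < len c) \<longleftrightarrow> len c \<noteq> 0" using ex_len[of 0] by (metis gr_zeroI not_less_zero)
    moreover have "(\<forall>s. pt s 0 \<le> a \<longrightarrow> pt s 0 \<le> b) \<longleftrightarrow> a \<le> b" for a b
      using ex_first[of a] order_trans by blast
    ultimately show ?thesis
      unfolding rectangle_le_iff val_def order_eq_iff[of "pt \<sigma> _"] by (cases "len c = 0") auto
  qed
  then show ?thesis by (simp only:) (intro Y_dfn)
qed

section \<open>Staircases, and the identification of lengths with first parts\<close>

definition staircase :: "partition \<Rightarrow> bool" where
  "staircase \<sigma> \<longleftrightarrow> (\<forall>i. pt \<sigma> i = pt \<sigma> 0 - i)"

lemma ex_staircase: "\<exists>\<sigma>. staircase \<sigma> \<and> pt \<sigma> 0 = n"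
proof -
  have "\<exists>\<sigma>. \<forall>i. pt \<sigma> i = n - i" by (rule ex_partition[where n = n]) (auto simp: antimono_def)
  then obtain \<sigma> where "\<forall>i. pt \<sigma> i = n - i" by blast
  then show ?thesis by (intro exI[of _ \<sigma>]) (simp add: staircase_def)
qed

lemma staircaseD: "staircase \<sigma> \<Longrightarrow> pt \<sigma> i = pt \<sigma> 0 - i"
  unfolding staircase_def by blast

lemma len_staircase: "staircase \<sigma> \<Longrightarrow> len \<sigma> = pt \<sigma> 0"
  using pt_eq_0_iff[of \<sigma> "pt \<sigma> 0"] pt_eq_0_iff[of \<sigma> "len \<sigma>"]
    staircaseD[of \<sigma> "pt \<sigma> 0"] staircaseD[of \<sigma> "len \<sigma>"] by simp

text \<open>Backward, row by row: for a nonzero row \<open>i\<close>, the value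
  \<open>pt \<sigma> i - 1\<close> occurs, by antitonicity only after row \<open>i\<close>, so row
  \<open>Suc i\<close> is at least that, while strict decrease bounds it from above.\<close>

lemma staircase_iff: "staircase \<sigma> \<longleftrightarrow>
  (\<forall>i j. i < j \<longrightarrow> pt \<sigma> j < pt \<sigma> i \<or> pt \<sigma> i = 0) \<and> (\<forall>n\<le>pt \<sigma> 0. \<exists>i. pt \<sigma> i = n)"
proof
  assume s: "staircase \<sigma>"
  have "\<exists>i. pt \<sigma> i = n" if "n \<le> pt \<sigma> 0" for n
    using that staircaseD[OF s, of "pt \<sigma> 0 - n"] by (intro exI[of _ "pt \<sigma> 0 - n"]) simp
  moreover have "pt \<sigma> j < pt \<sigma> i \<or> pt \<sigma> i = 0" if "i < j" for i j
  proof -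
    show ?thesis using staircaseD[OF s, of i] staircaseD[OF s, of j] that by linarith
  qed
  ultimately show "(\<forall>i j. i < j \<longrightarrow> pt \<sigma> j < pt \<sigma> i \<or> pt \<sigma> i = 0) \<and> (\<forall>n\<le>pt \<sigma> 0. \<exists>i. pt \<sigma> i = n)"
    by blast
next
  assume *: "(\<forall>i j. i < j \<longrightarrow> pt \<sigma> j < pt \<sigma> i \<or> pt \<sigma> i = 0) \<and> (\<forall>n\<le>pt \<sigma> 0. \<exists>i. pt \<sigma> i = n)"
  note dec = *[THEN conjunct1, rule_format] and onto = *[THEN conjunct2, rule_format]
  have "pt \<sigma> i = pt \<sigma> 0 - i" for i
  proof (induction i)
    case (Suc i)
    show ?case
    proof (cases "pt \<sigma> i = 0")
      case True
      then show ?thesis using Suc pt_antimono[of i "Suc i" \<sigma>] by simp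
    next
      case False
      then have less: "pt \<sigma> (Suc i) < pt \<sigma> i" using dec[of i "Suc i"] by simp
      obtain k where k: "pt \<sigma> k = pt \<sigma> i - 1" using onto[of "pt \<sigma> i - 1"] Suc by auto
      have "Suc i \<le> k"
      proof (rule ccontr)
        assume "\<not> Suc i \<le> k"
        then show False using pt_antimono[of k i \<sigma>] k False by simp
      qed
      then have "pt \<sigma> i - 1 \<le> pt \<sigma> (Suc i)" using pt_antimono[of "Suc i" k \<sigma>] k by simp
      with less Suc show ?thesis by simp
    qed
  qed simp
  then show "staircase \<sigma>" unfolding staircase_def by blast
qed

lemma Y_dfn_staircase: "Y.dfn (\<lambda>e. staircase (e i))"
proof -
  have "staircase \<sigma> \<longleftrightarrow>
    (\<forall>c d r s. val \<sigma> c r \<and> val \<sigma> d s \<and> len c < len d \<longrightarrow> pt s 0 < pt r 0 \<or> (\<forall>z. pt r 0 \<le> pt z 0)) \<and>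
    (\<forall>r. pt r 0 \<le> pt \<sigma> 0 \<longrightarrow> (\<exists>c. val \<sigma> c r))" for \<sigma>
  proof -
    \<comment> \<open>Zero is described as the least first part, since addition has not been defined
      yet.\<close>
    have zero: "(\<forall>z. pt r 0 \<le> pt z 0) \<longleftrightarrow> pt r 0 = 0" for r
      using ex_first[of 0] by (metis le_zero_eq zero_le)
    have "(\<forall>c d r s. val \<sigma> c r \<and> val \<sigma> d s \<and> len c < len d \<longrightarrow> pt s 0 < pt r 0 \<or> pt r 0 = 0) \<longleftrightarrow>
        (\<forall>i j. i < j \<longrightarrow> pt \<sigma> j < pt \<sigma> i \<or> pt \<sigma> i = 0)" (is "?L \<longleftrightarrow> ?R")
    proof
      assume L: ?L
      show ?R
      proof (intro allI impI)
        fix i j :: nat assume "i < j"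
        obtain c d r s where "len c = Suc i" "len d = Suc j" "pt r 0 = pt \<sigma> i" "pt s 0 = pt \<sigma> j"
          using ex_len ex_first by metis
        then show "pt \<sigma> j < pt \<sigma> i \<or> pt \<sigma> i = 0"
          using L[rule_format, of c r d s] \<open>i < j\<close> by (simp add: val_def)
      qed
    next
      assume R: ?R
      show ?L
      proof (intro allI impI)
        fix c d r s assume v: "val \<sigma> c r \<and> val \<sigma> d s \<and> len c < len d"
        then have "len c - 1 < len d - 1" unfolding val_def by linarith
        then have "pt \<sigma> (len d - 1) < pt \<sigma> (len c - 1) \<or> pt \<sigma> (len c - 1) = 0"
          by (rule R[rule_format])
        with v show "pt s 0 < pt r 0 \<or> pt r 0 = 0" by (simp only: val_def)
      qed
    qed
    moreover have "(\<forall>r. pt r 0 \<le> pt \<sigma> 0 \<longrightarrow> (\<exists>c. val \<sigma> c r)) \<longleftrightarrow> (\<forall>n\<le>pt \<sigma> 0. \<exists>i. pt \<sigma> i = n)"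
    proof -
      have "(\<exists>c. val \<sigma> c r) \<longleftrightarrow> (\<exists>i. pt \<sigma> i = pt r 0)" for r
        unfolding val_def by (metis ex_len diff_Suc_1 nat.distinct(1))
      then show ?thesis by (metis ex_first)
    qed
    ultimately show ?thesis unfolding staircase_iff zero by (simp only:)
  qed
  then show ?thesis by (simp only:) (intro Y_dfn Y_dfn_val)
qed

text \<open>A staircase has as many rows as its first part, and there is one of every size, so
  staircases convert lengths into first parts.\<close>

lemma Y_dfn_len_first: "Y.dfn (\<lambda>e. len (e i) = pt (e j) 0)"
proof -
  have "len \<tau> = pt \<rho> 0 \<longleftrightarrow> (\<exists>\<sigma>. staircase \<sigma> \<and> len \<sigma> = len \<tau> \<and> pt \<sigma> 0 = pt \<rho> 0)" for \<tau> \<rho>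
    by (metis ex_staircase len_staircase)
  then show ?thesis by (simp only:) (intro Y_dfn Y_dfn_staircase)
qed

text \<open>\<open>val\<close> counts rows from one, \<open>pt\<close> from zero; hence
  \<open>c\<close> has the length next after that of \<open>y\<close>, and this successor is
  expressed through the order of lengths.\<close>

lemma Y_dfn_pt: "Y.dfn (\<lambda>e. pt (e k) (pt (e i) 0) = pt (e j) 0)"
proof -
  have "pt \<sigma> (pt \<tau> 0) = pt \<rho> 0 \<longleftrightarrow> (\<exists>c y. len y = pt \<tau> 0 \<and> len y < len c \<and>
      (\<forall>z. len y < len z \<longrightarrow> len c \<le> len z) \<and> val \<sigma> c \<rho>)" for \<sigma> \<tau> \<rho>
  proof -
    have succ: "len y < len c \<and> (\<forall>z. len y < len z \<longrightarrow> len c \<le> len z) \<longleftrightarrow> len c = Suc (len y)" for c y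
      using ex_len[of "Suc (len y)"] by (metis Suc_leI le_antisym lessI)
    have "(\<exists>c y. len y = pt \<tau> 0 \<and> len c = Suc (len y) \<and> val \<sigma> c \<rho>) \<longleftrightarrow> pt \<sigma> (pt \<tau> 0) = pt \<rho> 0"
      unfolding val_def using ex_len by (metis diff_Suc_1 nat.distinct(1))
    then show ?thesis using succ by (metis (no_types, lifting))
  qed
  then show ?thesis by (simp only:) (intro Y_dfn Y_dfn_val Y_dfn_len_first)
qed

section \<open>Addition and multiplication of first parts\<close>

interpretation Y: additive_structure Ystar_rel "UNIV :: unit set" Ystar_cst "\<lambda>\<sigma>. pt \<sigma> 0"
proof unfold_locales
  show "surj (\<lambda>\<sigma>. pt \<sigma> 0)" using ex_first by (metis surjI)
  show "Y.dfn (\<lambda>e. pt (e i) 0 = pt (e j) 0)" for i j by (rule Y_dfn_first_eq)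
  \<comment> \<open>Row \<open>x\<close> of a staircase with first part \<open>n\<close> is
    \<open>n - x\<close>; the condition \<open>x \<le> n\<close> excludes truncation.\<close>
  have "x + y = pt \<rho> 0 \<longleftrightarrow>
      (\<exists>\<sigma>. staircase \<sigma> \<and> pt \<sigma> 0 = pt \<rho> 0 \<and> x \<le> pt \<rho> 0 \<and> pt \<sigma> x = y)" for x y \<rho>
  proof
    assume "x + y = pt \<rho> 0"
    moreover obtain \<sigma> where "staircase \<sigma>" "pt \<sigma> 0 = pt \<rho> 0" using ex_staircase by blast
    ultimately show "\<exists>\<sigma>. staircase \<sigma> \<and> pt \<sigma> 0 = pt \<rho> 0 \<and> x \<le> pt \<rho> 0 \<and> pt \<sigma> x = y"
      using staircaseD[of \<sigma> x] by (intro exI[of _ \<sigma>]) simp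
  next
    assume "\<exists>\<sigma>. staircase \<sigma> \<and> pt \<sigma> 0 = pt \<rho> 0 \<and> x \<le> pt \<rho> 0 \<and> pt \<sigma> x = y"
    then show "x + y = pt \<rho> 0" using staircaseD by (metis le_add_diff_inverse)
  qed
  then show "Y.dfn (\<lambda>e. pt (e i) 0 + pt (e j) 0 = pt (e k) 0)" for i j k
    by (simp only:) (intro Y_dfn Y_dfn_staircase Y_dfn_pt)
qed

lemma Y_dfn_term_pt:
  assumes "Y.dfn_term t" shows "Y.dfn_term (\<lambda>e. pt (e i) (t e))"
  by (rule Y.dfn_term_subst[where H = "\<lambda>e. pt (e i)", OF _ assms])
    (simp add: Y.dfn_term_def Y_dfn_pt)

text \<open>The partition with each of the parts \<open>m, \<dots>, 1\<close> repeated \<open>x\<close> times has length \<open>x * m\<close>.\<close>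
lemma times_iff: "x * m = p \<longleftrightarrow> (x = 0 \<and> p = 0) \<or> (\<not> x = 0 \<and>
  (\<exists>\<sigma>. (\<forall>i. i < x \<longrightarrow> pt \<sigma> i = m) \<and> (\<forall>i. pt \<sigma> (i + x) = pt \<sigma> i - 1) \<and>
     pt \<sigma> p = 0 \<and> (\<forall>i. i < p \<longrightarrow> \<not> pt \<sigma> i = 0)))"
proof (cases "x = 0")
  case False
  \<comment> \<open>Row \<open>i\<close> of the intended partition is \<open>m - i div x\<close>,
    whose first zero is at \<open>x * m\<close>.\<close>
  have zero: "m - i div x = 0 \<longleftrightarrow> x * m \<le> i" for i
    using False by (simp add: less_eq_div_iff_mult_less_eq mult.commute)
  show ?thesis
  proof
    assume p: "x * m = p"
    have "\<exists>\<sigma>. \<forall>i. pt \<sigma> i = m - i div x"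
      by (rule ex_partition[where n = "x * m"]) (use False in \<open>auto simp: antimono_def div_le_mono diff_le_mono2\<close>)
    then obtain \<sigma> where \<sigma>: "\<And>i. pt \<sigma> i = m - i div x" by blast
    have "pt \<sigma> (i + x) = pt \<sigma> i - 1" for i using False by (simp add: \<sigma> div_add_self2)
    moreover have "pt \<sigma> i = 0 \<longleftrightarrow> p \<le> i" for i unfolding \<sigma> zero p ..
    ultimately show "(x = 0 \<and> p = 0) \<or> (\<not> x = 0 \<and>
      (\<exists>\<sigma>. (\<forall>i. i < x \<longrightarrow> pt \<sigma> i = m) \<and> (\<forall>i. pt \<sigma> (i + x) = pt \<sigma> i - 1) \<and>
         pt \<sigma> p = 0 \<and> (\<forall>i. i < p \<longrightarrow> \<not> pt \<sigma> i = 0)))"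
      using False by (intro disjI2 conjI exI[of _ \<sigma>]) (auto simp: \<sigma>)
  next
    assume "(x = 0 \<and> p = 0) \<or> (\<not> x = 0 \<and>
      (\<exists>\<sigma>. (\<forall>i. i < x \<longrightarrow> pt \<sigma> i = m) \<and> (\<forall>i. pt \<sigma> (i + x) = pt \<sigma> i - 1) \<and>
         pt \<sigma> p = 0 \<and> (\<forall>i. i < p \<longrightarrow> \<not> pt \<sigma> i = 0)))"
    then obtain \<sigma> where \<sigma>: "\<And>i. i < x \<Longrightarrow> pt \<sigma> i = m" "\<And>i. pt \<sigma> (i + x) = pt \<sigma> i - 1"
      "pt \<sigma> p = 0" "\<And>i. i < p \<Longrightarrow> pt \<sigma> i \<noteq> 0" using False by blast
    \<comment> \<open>The first \<open>x\<close> rows and the truncated descent by one every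
      \<open>x\<close> rows determine the whole partition.\<close>
    have pt: "pt \<sigma> i = m - i div x" for i
    proof (induction i rule: less_induct)
      case (less i)
      show ?case
      proof (cases "i < x")
        case True
        then show ?thesis by (simp add: \<sigma>(1))
      next
        case i: False
        then have "pt \<sigma> i = (m - (i - x) div x) - 1"
          using \<sigma>(2)[of "i - x"] less[of "i - x"] False by simp
        also have "\<dots> = m - i div x" using i False by (simp add: le_div_geq)
        finally show ?thesis .
      qed
    qed
    have "x * m \<le> p" using \<sigma>(3) unfolding pt zero .
    moreover have "\<not> x * m < p" using \<sigma>(4)[of "x * m"] unfolding pt zero by blast
    ultimately show "x * m = p" by simp
  qed
qed auto

interpretation Y: arith_structure Ystar_rel "UNIV :: unit set" Ystar_cst "\<lambda>\<sigma>. pt \<sigma> 0"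
proof unfold_locales
  show "Y.dfn (\<lambda>e. pt (e i) 0 * pt (e j) 0 = pt (e k) 0)" for i j k
    unfolding times_iff by (intro Y.dfn_additive Y.dfn_term_diff Y_dfn_term_pt)
qed

text \<open>Numbers are represented here by first parts. Rows and lengths are definable in that
  representation, so the closure of terms under \<open>code_val\<close> yields the coding
  itself.\<close>

lemma Y_dfn_term_num: "Y.dfn_term (\<lambda>e. num (e i))"
  unfolding num_code_val
proof (rule Y.dfn_term_code_val[where s = "\<lambda>e. pt (e i)"])
  show "Y.dfn_term (\<lambda>e. pt (e (Suc i)) (pt (e 0) 0))" by (intro Y_dfn_term_pt Y.dfn_term_var)
  show "Y.dfn_term (\<lambda>e. len (e i))" unfolding Y.dfn_term_def by (rule Y_dfn_len_first)
qed

section \<open>Translation of atomic formulas in both directions\<close>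

lemma arith_subset_Y: "Def arith_rel ({} :: unit set) no_cst \<subseteq> Def Ystar_rel (UNIV :: unit set) Ystar_cst"
proof (rule Y.Def_subset)
  fix s t :: "unit trm" assume "csts (FEq s t :: (bool, unit) fm) \<subseteq> {}"
  then obtain i j where "s = Var i" "t = Var j" by (cases s; cases t) auto
  then show "Y.dfn (\<lambda>e. sat arith_rel no_cst e (FEq s t))" by (simp add: Y.dfn_eq)
next
  fix b :: bool and ts :: "unit trm list" assume c: "csts (FRel b ts) \<subseteq> {}"
  \<comment> \<open>Falsity is wanted for atoms whose number of arguments is not three;
    \<open>arith_rel\<close> makes them false.\<close>
  have "Y.dfn (\<lambda>e. \<not> e 0 = e 0)" by (intro Y.dfn_logic)
  then have F: "Y.dfn (\<lambda>e. False)" by simp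
  have T: "Y.dfn (\<lambda>e. if b then plus_rel (e i) (e j) (e k) else times_rel (e i) (e j) (e k))" for i j k
    by (cases b) (simp_all add: plus_rel_def times_rel_def Y.dfn_eqn Y.dfn_term_plus Y.dfn_term_times Y_dfn_term_num)
  show "Y.dfn (\<lambda>e. sat arith_rel no_cst e (FRel b ts))"
  proof (cases "\<exists>x y z. ts = [x, y, z]")
    case True
    then obtain x y z where ts: "ts = [x, y, z]" by blast
    with c obtain i j k where "x = Var i" "y = Var j" "z = Var k" by (cases x; cases y; cases z) auto
    with ts T show ?thesis by simp
  next
    case False
    then have "\<not> sat arith_rel no_cst e (FRel b ts)" for e by (auto split: list.splits)
    with F show ?thesis by (simp only:)
  qed
qed

lemma Y_subset_arith: "Def Ystar_rel (UNIV :: unit set) Ystar_cst \<subseteq> Def arith_rel ({} :: unit set) no_cst"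
proof (rule Ar.Def_subset)
  \<comment> \<open>A term is a variable or the constant, and the constant is definable in
    arithmetic as the partition with code 2.\<close>
  have elem: "Ar.dfn (\<lambda>e. e i = teval Ystar_cst (\<lambda>i. e (h i)) t)" for i h and t :: "unit trm"
    by (cases t) (simp_all add: Ar.dfn_eq Ystar_cst_def Ar_dfn_two_ones)
  have binary: "Ar.dfn (\<lambda>e. R (teval Ystar_cst e s) (teval Ystar_cst e t))"
    if R: "\<And>i j. Ar.dfn (\<lambda>e. R (e i) (e j))" for R and s t :: "unit trm"
    by (rule Ar.dfn_subst_elem[where R = "\<lambda>e x. R x (teval Ystar_cst e t)"],
        rule Ar.dfn_subst_elem[where R = "\<lambda>e y. R (e 0) y"]) (intro R elem)+
  show "Ar.dfn (\<lambda>e. sat Ystar_rel Ystar_cst e (FEq s t))" for s t :: "unit trm"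
    using binary[of "(=)", OF Ar.dfn_eq] by simp
  fix u and ts :: "unit trm list"
  have "Ar.dfn (\<lambda>e. \<not> e 0 = e 0)" by (intro Ar.dfn_logic)
  then have F: "Ar.dfn (\<lambda>e. False)" by simp
  show "Ar.dfn (\<lambda>e. sat Ystar_rel Ystar_cst e (FRel u ts))"
  proof (cases "\<exists>x y. ts = [x, y]")
    case True
    then show ?thesis using binary[of young_le, OF Ar_dfn_young_le] by auto
  next
    case False
    then have "\<not> sat Ystar_rel Ystar_cst e (FRel u ts)" for e by (auto split: list.splits)
    with F show ?thesis by (simp only:)
  qed
qed

theorem theorem4p4:
  shows "Def Ystar_rel (UNIV :: unit set) Ystar_cst = Def arith_rel ({} :: unit set) no_cst"
  by (rule equalityI[OF Y_subset_arith arith_subset_Y])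

end
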